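(* Let $T$ be any triangulation of the torus $\mathbb{T} = \mathbb{S}^1 \times \mathbb{S}^1$, and let $n_0^T, n_1^T, n_2^T$ be respectively the numbers of vertices, edges and triangles of $T$. Then $$n_0^T - n_1^T + n_2^T = 0.$$
   Context: A triangulation of a compact surface is a finite two-dimensional simplicial complex together with a homeomorphism from its geometric realization onto the surface. *)

theory Defs
  imports "HOL-Analysis.Analysis" "HOL-Homology.Homology"
begin

text \<open>
  Simplices are the nonempty finite vertex sets belonging to the complex (the empty simplex is
  excluded); every point of \<open>\<Union>K\<close> is a vertex by closure under nonempty subsets.
\<close>

definition abstract_simplicial_complex :: "'v set set \<Rightarrow> bool" where
  "abstract_simplicial_complex K \<longleftrightarrow>
     (\<forall>\<sigma>\<in>K. finite \<sigma> \<and> \<sigma> \<noteq> {}) \<and>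
     (\<forall>\<sigma>\<in>K. \<forall>\<tau>. \<tau> \<subseteq> \<sigma> \<and> \<tau> \<noteq> {} \<longrightarrow> \<tau> \<in> K)"

definition n_simplices :: "nat \<Rightarrow> 'v set set \<Rightarrow> 'v set set" where
  "n_simplices n K = {\<sigma> \<in> K. card \<sigma> = n + 1}"

definition has_dimension :: "'v set set \<Rightarrow> nat \<Rightarrow> bool" where
  "has_dimension K n \<longleftrightarrow> n_simplices n K \<noteq> {} \<and> (\<forall>\<sigma>\<in>K. card \<sigma> \<le> n + 1)"

text \<open>
  Points are given by their barycentric coordinates, with support a simplex of \<open>K\<close>. The topology
  is the one inherited from the product topology on \<open>'v \<Rightarrow> real\<close>, as for \<open>standard_simplex\<close>; for
  finite \<open>K\<close> this is the usual topology of the geometric realization.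
\<close>

definition geometric_realization :: "'v set set \<Rightarrow> ('v \<Rightarrow> real) set" where
  "geometric_realization K =
     {x. (\<forall>v. 0 \<le> x v) \<and> {v. x v \<noteq> 0} \<in> K \<and> (\<Sum>v | x v \<noteq> 0. x v) = 1}"

definition surface_triangulation ::
    "'v set set \<Rightarrow> (('v \<Rightarrow> real) \<Rightarrow> 'a::topological_space) \<Rightarrow> 'a set \<Rightarrow> bool" where
  "surface_triangulation K h M \<longleftrightarrow>
     finite K \<and> abstract_simplicial_complex K \<and> has_dimension K 2 \<and>
     (\<exists>g. homeomorphism (geometric_realization K) M h g)"

definition torus :: "(complex \<times> complex) set" where
  "torus = sphere 0 1 \<times> sphere 0 1"

end

theory Submission
  imports Defs
begin

text \<open>
  A triangulation \<open>K\<close> of the torus pulls back along the double cover \<open>(z, w) \<mapsto> (z\<^sup>2, w)\<close> to a complex \<open>L\<close>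
  with twice as many simplices in each dimension. The deck transformation \<open>(z, w) \<mapsto> (- z, w)\<close> maps no
  simplex of \<open>L\<close> to itself, yet it is homotopic to the identity by rotating the first coordinate.
  The identity and the deck transformation therefore induce chain homotopic endomorphisms of the simplicial
  chain complex of \<open>L\<close>, the second one with zero diagonal. The alternating sum of the traces of
  \<open>\<partial>D + D\<partial>\<close> vanishes, so the Euler characteristic of \<open>L\<close>, which is twice that of \<open>K\<close>, is 0.

  To obtain \<open>D\<close>, a simplex is subdivided as a singular chain until its pieces are small, the pieces are moved
  along the homotopy in small steps, and at each time the corners of a piece are replaced by vertices of \<open>L\<close>
  whose open stars contain a neighbourhood of the corner. Consecutive times give contiguous simplices, hence
  a combinatorial prism.
\<close>

text \<open>Rotating the torus itself is already homotopic to the identity and free, but a cell of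
  the given complex may be so wide that a rotation carries it into the stars of its own vertices,
  and then the induced chain map can have a nonzero diagonal. Refining the complex would require
  comparing Euler characteristics before and after. Subdivision enters only through singular chains
  used to build the homotopy operator; the complex whose simplices are counted stays the same. No
  homology group is computed: the traces are those of integer matrices on chains.\<close>

section \<open>Oriented simplices and supertraces\<close>

text \<open>The sign of the permutation that sorts a list of distinct vertices, and 0 if a vertex is repeated.\<close>

fun order_sign :: "int list \<Rightarrow> int" where
  "order_sign [] = 1"
| "order_sign (a # vs) = (\<Prod>b\<leftarrow>vs. sgn (b - a)) * order_sign vs"

text \<open>The basis consists of vertex sets, each oriented by the order of the integers, so that a
  trace is a sum over simplices. Corners of singular pieces and prisms come as lists; this is the
  passage between the two.\<close>

definition alt_simplex :: "int list \<Rightarrow> int set \<Rightarrow>\<^sub>0 int" where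
  "alt_simplex vs = frag_cmul (order_sign vs) (frag_of (set vs))"

definition vertex_rank :: "int set \<Rightarrow> int \<Rightarrow> nat" where
  "vertex_rank S v = card {u \<in> S. u < v}"

text \<open>This is the augmented boundary: a vertex goes to the empty set. The homotopy argument
  applies it in degrees 1 and 2 only, where the augmentation is invisible.\<close>

definition set_boundary :: "(int set \<Rightarrow>\<^sub>0 int) \<Rightarrow> int set \<Rightarrow>\<^sub>0 int" where
  "set_boundary = frag_extend (\<lambda>S. \<Sum>s\<in>S. frag_cmul ((-1) ^ vertex_rank S s) (frag_of (S - {s})))"

lemma order_sign_eq_0_iff: "order_sign vs = 0 \<longleftrightarrow> \<not> distinct vs"
  by (induction vs) (auto simp: prod_list_zero_iff sgn_if)

lemma keys_alt_simplex:
  "Poly_Mapping.keys (alt_simplex vs) = (if distinct vs then {set vs} else {})"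
  by (auto simp: alt_simplex_def order_sign_eq_0_iff)

lemma set_boundary_pair:
  assumes "a < b"
  shows "set_boundary (frag_of {a, b}) = frag_of {b} - frag_of {a}"
proof -
  have *: "{u \<in> {a, b}. u < a} = {}" "{u \<in> {a, b}. u < b} = {a}"
    using assms by auto
  have "vertex_rank {a, b} a = 0" "vertex_rank {a, b} b = 1"
    unfolding vertex_rank_def * by simp_all
  moreover have "{a, b} - {a} = {b}" "{a, b} - {b} = {a}"
    using assms by auto
  ultimately show ?thesis
    using assms by (simp add: set_boundary_def)
qed

lemma set_boundary_triple:
  assumes "a < b" "b < c"
  shows "set_boundary (frag_of {a, b, c}) = frag_of {b, c} - frag_of {a, c} + frag_of {a, b}"
proof -
  have *: "{u \<in> {a, b, c}. u < a} = {}" "{u \<in> {a, b, c}. u < b} = {a}"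
    "{u \<in> {a, b, c}. u < c} = {a, b}"
    using assms by auto
  have "vertex_rank {a, b, c} a = 0" "vertex_rank {a, b, c} b = 1" "vertex_rank {a, b, c} c = 2"
    unfolding vertex_rank_def * using assms by simp_all
  moreover have "{a, b, c} - {a} = {b, c}" "{a, b, c} - {b} = {a, c}" "{a, b, c} - {c} = {a, b}"
    using assms by auto
  ultimately show ?thesis
    using assms by (simp add: set_boundary_def)
qed

lemma set_boundary_alt_pair:
  "set_boundary (alt_simplex [a, b]) = alt_simplex [b] - alt_simplex [a]"
proof -
  consider "a = b" | "a < b" | "b < a" by linarith
  then show ?thesis
  proof cases
    case 3
    then show ?thesis
      using set_boundary_pair [of b a]
      by (simp add: alt_simplex_def set_boundary_def frag_extend_minus insert_commute)
  qed (auto simp: alt_simplex_def set_boundary_pair, simp add: set_boundary_def)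
qed

lemma set_boundary_alt_triple:
  "set_boundary (alt_simplex [a, b, c]) =
     alt_simplex [b, c] - alt_simplex [a, c] + alt_simplex [a, b]"
proof (cases "distinct [a, b, c]")
  case False
  then show ?thesis
    by (auto simp: alt_simplex_def set_boundary_def insert_commute sgn_if)
next
  case True
  have mns: "set_boundary (- x) = - set_boundary x" for x
    by (simp add: set_boundary_def frag_extend_minus)
  consider "a < b" "b < c" | "a < c" "c < b" | "b < a" "a < c" | "b < c" "c < a"
    | "c < a" "a < b" | "c < b" "b < a"
    using True by fastforce
  then show ?thesis
  proof cases
    case 1 then show ?thesis using set_boundary_triple [of a b c]
      by (simp add: alt_simplex_def mns insert_commute)
  next
    case 2 then show ?thesis using set_boundary_triple [of a c b]
      by (simp add: alt_simplex_def mns insert_commute)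
  next
    case 3 then show ?thesis using set_boundary_triple [of b a c]
      by (simp add: alt_simplex_def mns insert_commute)
  next
    case 4 then show ?thesis using set_boundary_triple [of b c a]
      by (simp add: alt_simplex_def mns insert_commute)
  next
    case 5 then show ?thesis using set_boundary_triple [of c a b]
      by (simp add: alt_simplex_def mns insert_commute)
  next
    case 6 then show ?thesis using set_boundary_triple [of c b a]
      by (simp add: alt_simplex_def mns insert_commute)
  qed
qed

text \<open>The two faces that omit one of two equal entries agree up to a permutation whose sign
  cancels them, and the other two faces still contain a repetition. For nonadjacent entries the sign
  comes from \<open>sgn_swap\<close>.\<close>

lemma alt_boundary_degenerate_quadruple:
  assumes "\<not> distinct [a, b, c, d]"
  shows "alt_simplex [b, c, d] - alt_simplex [a, c, d] + alt_simplex [a, b, d] - alt_simplex [a, b, c] = 0"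
proof -
  have sgn_swap: "sgn (x - y) = - sgn (y - x)" for x y :: int
    by (simp add: sgn_if)
  consider "a = b" | "a = c" | "a = d" | "b = c" | "b = d" | "c = d"
    using assms by auto
  then show ?thesis
  proof cases
    case 2
    then show ?thesis
      using sgn_swap [of b c] by (simp add: alt_simplex_def insert_commute mult_ac flip: frag_cmul_distrib)
  next
    case 3
    then show ?thesis
      using sgn_swap [of b d] sgn_swap [of c d]
      by (simp add: alt_simplex_def insert_commute mult_ac flip: frag_cmul_distrib)
  next
    case 5
    then show ?thesis
      using sgn_swap [of c d] by (simp add: alt_simplex_def insert_commute mult_ac flip: frag_cmul_distrib)
  qed (simp_all add: alt_simplex_def insert_commute flip: frag_cmul_distrib)
qed

text \<open>Deleting distinct vertices leaves distinct facets, so no terms cancel. This lets the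
  coefficient of a multiple of a simplex be read off from its boundary.\<close>

lemma set_boundary_nonzero:
  assumes "finite S" "S \<noteq> {}"
  shows "set_boundary (frag_of S) \<noteq> 0"
proof -
  obtain s where s: "s \<in> S" using assms by blast
  have "Poly_Mapping.lookup (set_boundary (frag_of S)) (S - {s})
      = (\<Sum>t\<in>S. if t = s then (-1) ^ vertex_rank S s else 0)"
    unfolding set_boundary_def frag_extend_of lookup_sum
    by (rule sum.cong) (use s in auto)
  also have "\<dots> \<noteq> 0"
    using s assms by simp
  finally show ?thesis by auto
qed

lemma keys_set_boundary_frag_of:
  "Poly_Mapping.keys (set_boundary (frag_of S)) \<subseteq> (\<lambda>s. S - {s}) ` S"
proof -
  have "Poly_Mapping.keys (set_boundary (frag_of S))
      \<subseteq> (\<Union>s\<in>S. Poly_Mapping.keys (frag_cmul ((-1) ^ vertex_rank S s) (frag_of (S - {s}))))"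
    unfolding set_boundary_def frag_extend_of by (rule keys_sum)
  then show ?thesis by auto
qed

section \<open>Coefficients and traces\<close>

lemma lookup_frag_extend:
  assumes "finite A" "Poly_Mapping.keys c \<subseteq> A"
  shows "Poly_Mapping.lookup (frag_extend f c) x =
     (\<Sum>y\<in>A. Poly_Mapping.lookup c y * Poly_Mapping.lookup (f y) x)"
proof -
  have "Poly_Mapping.lookup (frag_extend f c) x =
     (\<Sum>y\<in>Poly_Mapping.keys c. Poly_Mapping.lookup c y * Poly_Mapping.lookup (f y) x)"
    by (simp add: frag_extend_def lookup_sum)
  also have "\<dots> = (\<Sum>y\<in>A. Poly_Mapping.lookup c y * Poly_Mapping.lookup (f y) x)"
    by (rule sum.mono_neutral_left) (use assms in \<open>auto simp: in_keys_iff\<close>)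
  finally show ?thesis .
qed

lemma frag_extend_frag_extend:
  "frag_extend f (frag_extend g c) = frag_extend (\<lambda>x. frag_extend f (g x)) c"
  using subset_UNIV by (induction c rule: frag_induction) (auto simp: frag_extend_diff)

text \<open>Cyclicity of the trace: each of \<open>D0\<close> and \<open>D1\<close> contributes the
  same number to two consecutive degrees, once through \<partial>D and once through D\<partial>, and
  the alternating sum cancels them. The last three hypotheses say that \<partial>D + D\<partial> has
  diagonal -1 throughout.\<close>

lemma supertrace_commutator_zero:
  fixes K0 K1 K2 :: "int set set"
  assumes fin: "finite K0" "finite K1" "finite K2"
    and D0: "\<And>S. S \<in> K0 \<Longrightarrow> Poly_Mapping.keys (D0 S) \<subseteq> K1"
    and D1: "\<And>S. S \<in> K1 \<Longrightarrow> Poly_Mapping.keys (D1 S) \<subseteq> K2"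
    and faces1: "\<And>S. S \<in> K1 \<Longrightarrow> Poly_Mapping.keys (set_boundary (frag_of S)) \<subseteq> K0"
    and faces2: "\<And>S. S \<in> K2 \<Longrightarrow> Poly_Mapping.keys (set_boundary (frag_of S)) \<subseteq> K1"
    and tr0: "\<And>S. S \<in> K0 \<Longrightarrow> Poly_Mapping.lookup (set_boundary (D0 S)) S = - 1"
    and tr1: "\<And>S. S \<in> K1 \<Longrightarrow>
      Poly_Mapping.lookup (set_boundary (D1 S) + frag_extend D0 (set_boundary (frag_of S))) S = - 1"
    and tr2: "\<And>S. S \<in> K2 \<Longrightarrow>
      Poly_Mapping.lookup (frag_extend D1 (set_boundary (frag_of S))) S = - 1"
  shows "int (card K0) - int (card K1) + int (card K2) = 0"
proof -
  let ?b = "\<lambda>S. set_boundary (frag_of S)"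
  \<comment> \<open>Both tr(\<partial>D) and tr(D\<partial>) equal this double sum over the two
    bases; \<open>bE\<close> and \<open>Eb\<close> evaluate it in the two orders.\<close>
  define E where "E = (\<lambda>A B (D :: int set \<Rightarrow> int set \<Rightarrow>\<^sub>0 int).
    \<Sum>S\<in>A. \<Sum>R\<in>B. Poly_Mapping.lookup (D S) R * Poly_Mapping.lookup (?b R) S)"
  have bE: "(\<Sum>S\<in>A. Poly_Mapping.lookup (set_boundary (D S)) S) = E A B D"
    if "finite B" "\<And>S. S \<in> A \<Longrightarrow> Poly_Mapping.keys (D S) \<subseteq> B" for A B D
    unfolding E_def
  proof (rule sum.cong [OF refl])
    fix S assume "S \<in> A"
    then show "Poly_Mapping.lookup (set_boundary (D S)) S =
      (\<Sum>R\<in>B. Poly_Mapping.lookup (D S) R * Poly_Mapping.lookup (?b R) S)"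
      using lookup_frag_extend [OF that(1) that(2)] by (simp add: set_boundary_def)
  qed
  have Eb: "(\<Sum>R\<in>B. Poly_Mapping.lookup (frag_extend D (?b R)) R) = E A B D"
    if "finite A" "\<And>R. R \<in> B \<Longrightarrow> Poly_Mapping.keys (?b R) \<subseteq> A" for A B D
  proof -
    have "(\<Sum>R\<in>B. Poly_Mapping.lookup (frag_extend D (?b R)) R)
        = (\<Sum>R\<in>B. \<Sum>S\<in>A. Poly_Mapping.lookup (D S) R * Poly_Mapping.lookup (?b R) S)"
      by (rule sum.cong [OF refl]) (subst lookup_frag_extend [OF that], auto simp: mult.commute)
    then show ?thesis
      unfolding E_def by (subst sum.swap) 
  qed
  have "- int (card K0) = E K0 K1 D0"
    using bE [of K1 K0 D0] fin D0 tr0 by simp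
  moreover have "- int (card K1) = E K1 K2 D1 + E K0 K1 D0"
  proof -
    have "(\<Sum>S\<in>K1. Poly_Mapping.lookup (set_boundary (D1 S)) S
            + Poly_Mapping.lookup (frag_extend D0 (?b S)) S) = - int (card K1)"
      using tr1 by (simp add: lookup_add)
    then show ?thesis
      using bE [of K2 K1 D1] Eb [of K0 K1 D0] fin D1 faces1 by (simp add: sum.distrib)
  qed
  moreover have "- int (card K2) = E K1 K2 D1"
    using Eb [of K1 K2 D1] fin faces2 tr2 by simp
  ultimately show ?thesis by linarith
qed

section \<open>From simplices to singular chains and back\<close>

lemma singular_chain_subdivision_power:
  "singular_chain p X c \<Longrightarrow> singular_chain p X ((singular_subdivision p ^^ m) c)"
  by (induction m) (auto intro: singular_chain_singular_subdivision)

lemma chain_boundary_subdivision_power: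
  assumes "singular_chain p X c"
  shows "chain_boundary p ((singular_subdivision p ^^ m) c) =
    (singular_subdivision (p - Suc 0) ^^ m) (chain_boundary p c)"
  by (induction m)
    (auto simp: chain_boundary_singular_subdivision [OF singular_chain_subdivision_power [OF assms]])

lemma singular_subdivision_power_cmul:
  "(singular_subdivision p ^^ m) (frag_cmul k c) = frag_cmul k ((singular_subdivision p ^^ m) c)"
  by (induction m) (auto simp: singular_subdivision_def frag_extend_cmul)

lemma singular_subdivision_power_add:
  "(singular_subdivision p ^^ m) (a + b) = (singular_subdivision p ^^ m) a + (singular_subdivision p ^^ m) b"
  by (induction m) (auto simp: singular_subdivision_add)

lemma singular_subdivision_power_sum:
  "(singular_subdivision p ^^ m) (\<Sum>i\<in>I. c i) = (\<Sum>i\<in>I. (singular_subdivision p ^^ m) (c i))"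
  by (induction I rule: infinite_finite_induct) (auto simp: singular_subdivision_power_add)

section \<open>Parametrizing a simplex by the ranks of its vertices\<close>

lemma vertex_rank_mono:
  assumes "finite S" "u \<in> S" "u < v"
  shows "vertex_rank S u < vertex_rank S v"
  unfolding vertex_rank_def by (rule psubset_card_mono) (use assms in auto)

lemma bij_betw_vertex_rank:
  assumes "finite S"
  shows "bij_betw (vertex_rank S) S {..<card S}"
proof -
  have inj: "inj_on (vertex_rank S) S"
    by (rule linorder_inj_onI) (use vertex_rank_mono [OF assms] in \<open>auto dest: less_imp_neq\<close>)
  have "vertex_rank S ` S \<subseteq> {..<card S}"
    unfolding vertex_rank_def by (auto intro!: psubset_card_mono simp: assms)
  moreover have "card (vertex_rank S ` S) = card {..<card S}"
    using inj by (simp add: card_image)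
  ultimately show ?thesis
    using inj card_subset_eq unfolding bij_betw_def by blast
qed

lemma vertex_rank_remove:
  assumes "finite S" "s \<in> S" "v \<in> S" "v \<noteq> s"
  shows "vertex_rank S v =
    (if v < s then vertex_rank (S - {s}) v else Suc (vertex_rank (S - {s}) v))"
proof (cases "v < s")
  case True
  then have "{u \<in> S. u < v} = {u \<in> S - {s}. u < v}" by auto
  with True show ?thesis by (simp add: vertex_rank_def)
next
  case False
  then have "{u \<in> S. u < v} = insert s {u \<in> S - {s}. u < v}" using assms by auto
  with False assms show ?thesis by (simp add: vertex_rank_def)
qed

text \<open>Ordering the vertices by rank makes the sign of a singular face agree with the sign in
  \<open>set_boundary\<close>.\<close>

definition simplex_point :: "int set \<Rightarrow> (nat \<Rightarrow> real) \<Rightarrow> int \<Rightarrow> real" where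
  "simplex_point S x = (\<lambda>v. if v \<in> S then x (vertex_rank S v) else 0)"

text \<open>The face map puts a zero in slot \<open>vertex_rank S s\<close> and shifts the later
  slots by one, just as deleting \<open>s\<close> lowers the ranks of the larger vertices by
  one.\<close>

lemma simplex_point_simplical_face:
  assumes "finite S" "s \<in> S"
  shows "simplex_point S (simplical_face (vertex_rank S s) x) = simplex_point (S - {s}) x"
proof
  fix v
  consider "v \<notin> S" | "v = s" | "v \<in> S" "v < s" | "v \<in> S" "s < v" by linarith
  then show "simplex_point S (simplical_face (vertex_rank S s) x) v = simplex_point (S - {s}) x v"
  proof cases
    case 3
    then show ?thesis
      using assms vertex_rank_mono [of S v s] vertex_rank_remove [of S s v]
      by (simp add: simplex_point_def simplical_face_def)
  next
    case 4
    then show ?thesis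
      using assms vertex_rank_mono [of S s v] vertex_rank_remove [of S s v]
      by (simp add: simplex_point_def simplical_face_def)
  qed (use assms in \<open>auto simp: simplex_point_def simplical_face_def\<close>)
qed

lemma geometric_realization_sum:
  assumes "x \<in> geometric_realization K" "finite S" "{v. x v \<noteq> 0} \<subseteq> S"
  shows "sum x S = 1"
proof -
  have "sum x S = (\<Sum>v | x v \<noteq> 0. x v)"
    by (rule sum.mono_neutral_right) (use assms in auto)
  with assms show ?thesis by (simp add: geometric_realization_def)
qed

lemma geometric_realizationI:
  assumes K: "abstract_simplicial_complex K" and S: "S \<in> K"
    and nonneg: "\<And>v. 0 \<le> x v" and supp: "{v. x v \<noteq> 0} \<subseteq> S" and sum: "sum x S = 1"
  shows "x \<in> geometric_realization K"
proof -
  have "finite S"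
    using K S by (auto simp: abstract_simplicial_complex_def)
  then have "sum x S = (\<Sum>v | x v \<noteq> 0. x v)"
    by (rule sum.mono_neutral_right) (use supp in auto)
  with sum have sum': "(\<Sum>v | x v \<noteq> 0. x v) = 1"
    by simp
  then have "{v. x v \<noteq> 0} \<noteq> {}"
    by (metis sum.empty zero_neq_one)
  then have "{v. x v \<noteq> 0} \<in> K"
    using K S supp unfolding abstract_simplicial_complex_def by blast
  with sum' nonneg show ?thesis
    by (simp add: geometric_realization_def)
qed

lemma simplex_point_in_realization:
  assumes K: "abstract_simplicial_complex K" "S \<in> K" and x: "x \<in> standard_simplex (card S - 1)"
  shows "simplex_point S x \<in> geometric_realization K" "{v. simplex_point S x v \<noteq> 0} \<subseteq> S"
proof -
  have fin: "finite S" "S \<noteq> {}"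
    using K by (auto simp: abstract_simplicial_complex_def)
  then have eq: "{..<card S} = {..card S - 1}"
    by (metis Suc_diff_1 card_gt_0_iff lessThan_Suc_atMost)
  show supp: "{v. simplex_point S x v \<noteq> 0} \<subseteq> S"
    by (auto simp: simplex_point_def)
  have "sum (simplex_point S x) S = (\<Sum>v\<in>S. x (vertex_rank S v))"
    by (simp add: simplex_point_def)
  also have "\<dots> = sum x {..<card S}"
    by (rule sum.reindex_bij_betw [OF bij_betw_vertex_rank [OF fin(1)]])
  also have "\<dots> = 1"
    using x by (simp add: eq standard_simplex_def)
  finally have "sum (simplex_point S x) S = 1" .
  then show "simplex_point S x \<in> geometric_realization K"
    using K supp x by (intro geometric_realizationI [of K S]) (auto simp: simplex_point_def standard_simplex_def)
qed

text \<open>A singular simplex must be undefined off the standard simplex; with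
  \<open>restrict\<close>, the faces in \<open>singular_face_realize\<close> are equal as
  functions.\<close>

definition realize_simplex :: "((int \<Rightarrow> real) \<Rightarrow> 'a) \<Rightarrow> int set \<Rightarrow> (nat \<Rightarrow> real) \<Rightarrow> 'a" where
  "realize_simplex f S = restrict (f \<circ> simplex_point S) (standard_simplex (card S - 1))"

lemma singular_simplex_realize:
  assumes K: "abstract_simplicial_complex K" "S \<in> K"
    and f: "continuous_on (geometric_realization K) f"
  shows "singular_simplex (card S - 1)
    (top_of_set (f ` {x \<in> geometric_realization K. {v. x v \<noteq> 0} \<subseteq> S})) (realize_simplex f S)"
proof -
  have cont: "continuous_on A (simplex_point S)" for A
    unfolding simplex_point_def
  proof (rule continuous_on_coordinatewise_then_product)
    fix v
    have "continuous_on A (\<lambda>x. x (vertex_rank S v) :: real)"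
      by (rule continuous_on_product_then_coordinatewise) (rule continuous_on_id)
    then show "continuous_on A (\<lambda>x. if v \<in> S then x (vertex_rank S v) else 0)"
      by (cases "v \<in> S") auto
  qed
  have img: "simplex_point S ` standard_simplex (card S - 1)
      \<subseteq> {x \<in> geometric_realization K. {v. x v \<noteq> 0} \<subseteq> S}"
    using simplex_point_in_realization [OF K] by blast
  have "continuous_on (standard_simplex (card S - 1)) (f \<circ> simplex_point S)"
    using img by (intro continuous_on_compose cont continuous_on_subset [OF f]) auto
  moreover have "(f \<circ> simplex_point S) ` standard_simplex (card S - 1)
      \<subseteq> f ` {x \<in> geometric_realization K. {v. x v \<noteq> 0} \<subseteq> S}"
    using img by auto
  ultimately have "continuous_map (top_of_set (standard_simplex (card S - 1)))
      (top_of_set (f ` {x \<in> geometric_realization K. {v. x v \<noteq> 0} \<subseteq> S})) (f \<circ> simplex_point S)"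
    by (auto simp: image_subset_iff)
  then show ?thesis
    by (auto simp: singular_simplex_def realize_simplex_def euclidean_product_topology Pi_iff)
qed

lemma singular_face_realize:
  assumes "finite S" "s \<in> S" "2 \<le> card S"
  shows "singular_face (card S - 1) (vertex_rank S s) (realize_simplex f S) = realize_simplex f (S - {s})"
proof -
  have "vertex_rank S s < card S"
    using assms bij_betw_vertex_rank [of S] by (auto simp: bij_betw_def)
  then have "simplical_face (vertex_rank S s) x \<in> standard_simplex (card S - 1)"
    if "x \<in> standard_simplex (card S - 1 - Suc 0)" for x
    using that assms by (intro simplical_face_in_standard_simplex) auto
  then show ?thesis
    using assms by (auto simp: singular_face_def realize_simplex_def fun_eq_iff restrict_def
        simplex_point_simplical_face)
qed

lemma chain_boundary_realize:
  assumes "finite S" "2 \<le> card S"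
  shows "chain_boundary (card S - 1) (frag_of (realize_simplex f S)) =
    (\<Sum>s\<in>S. frag_cmul ((-1) ^ vertex_rank S s) (frag_of (realize_simplex f (S - {s}))))"
proof -
  have eq: "{..card S - 1} = {..<card S}"
    using assms(2) by auto
  have "chain_boundary (card S - 1) (frag_of (realize_simplex f S)) =
    (\<Sum>k<card S. frag_cmul ((-1) ^ k) (frag_of (singular_face (card S - 1) k (realize_simplex f S))))"
    unfolding chain_boundary_of eq using assms by simp
  also have "\<dots> = (\<Sum>s\<in>S. frag_cmul ((-1) ^ vertex_rank S s)
      (frag_of (singular_face (card S - 1) (vertex_rank S s) (realize_simplex f S))))"
    by (rule sum.reindex_bij_betw [OF bij_betw_vertex_rank [OF assms(1)], symmetric])
  also have "\<dots> = (\<Sum>s\<in>S. frag_cmul ((-1) ^ vertex_rank S s) (frag_of (realize_simplex f (S - {s}))))"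
    by (rule sum.cong [OF refl]) (simp only: singular_face_realize [OF assms(1) _ assms(2)])
  finally show ?thesis .
qed

section \<open>Vertex choices at the corners, and the prism between two choices\<close>

definition vertex_tuple :: "('a \<Rightarrow> int) \<Rightarrow> nat \<Rightarrow> ((nat \<Rightarrow> real) \<Rightarrow> 'a) \<Rightarrow> int list" where
  "vertex_tuple w p g = map (\<lambda>j. w (g (\<lambda>i. if i = j then 1 else 0))) [0..<Suc p]"

text \<open>The chain map of simplicial approximation. It commutes with the boundaries for an
  arbitrary function \<open>w\<close>, continuous or not; small pieces are needed only to make the
  prisms land in the complex.\<close>

definition vertex_chain :: "('a \<Rightarrow> int) \<Rightarrow> nat \<Rightarrow> 'a chain \<Rightarrow> int set \<Rightarrow>\<^sub>0 int" where
  "vertex_chain w p = frag_extend (\<lambda>g. alt_simplex (vertex_tuple w p g))"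

text \<open>The prism operators between two vertex choices, in the degrees where their values can be nonzero:
  in a complex of dimension 2 the prism over a triangle is degenerate.\<close>

definition prism0 :: "('a \<Rightarrow> int) \<Rightarrow> ('a \<Rightarrow> int) \<Rightarrow> 'a chain \<Rightarrow> int set \<Rightarrow>\<^sub>0 int" where
  "prism0 w w' = frag_extend (\<lambda>g.
     case (vertex_tuple w 0 g, vertex_tuple w' 0 g) of ([a], [a']) \<Rightarrow> alt_simplex [a, a'])"

definition prism1 :: "('a \<Rightarrow> int) \<Rightarrow> ('a \<Rightarrow> int) \<Rightarrow> 'a chain \<Rightarrow> int set \<Rightarrow>\<^sub>0 int" where
  "prism1 w w' = frag_extend (\<lambda>g.
     case (vertex_tuple w 1 g, vertex_tuple w' 1 g) of
       ([a, b], [a', b']) \<Rightarrow> alt_simplex [a, a', b'] - alt_simplex [a, b, b'])"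

lemma singular_face_corner:
  assumes "j \<le> p - Suc 0"
  shows "singular_face p k g (\<lambda>i. if i = j then 1 else 0) =
    g (\<lambda>i. if i = (if j < k then j else Suc j) then 1 else 0)"
proof -
  have "simplical_face k (\<lambda>i. if i = j then 1 else 0) =
      (\<lambda>i. if i = (if j < k then j else Suc j) then 1 else (0::real))"
    by (auto simp: simplical_face_def fun_eq_iff)
  then show ?thesis
    using assms by (simp add: singular_face_def)
qed

lemma vertex_tuple_expand:
  "vertex_tuple w 0 g = [w (g (\<lambda>i. if i = 0 then 1 else 0))]"
  "vertex_tuple w (Suc 0) g = [w (g (\<lambda>i. if i = 0 then 1 else 0)), w (g (\<lambda>i. if i = Suc 0 then 1 else 0))]"
  "vertex_tuple w 2 g = [w (g (\<lambda>i. if i = 0 then 1 else 0)), w (g (\<lambda>i. if i = Suc 0 then 1 else 0)),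
     w (g (\<lambda>i. if i = 2 then 1 else 0))]"
  by (simp_all add: vertex_tuple_def upt_rec numeral_2_eq_2)

lemma chain_boundary_1_of:
  "chain_boundary (Suc 0) (frag_of g) = frag_of (singular_face 1 0 g) - frag_of (singular_face 1 1 g)"
  by (simp add: chain_boundary_of)

lemma chain_boundary_2_of:
  "chain_boundary 2 (frag_of g) =
     frag_of (singular_face 2 0 g) - frag_of (singular_face 2 1 g) + frag_of (singular_face 2 2 g)"
  by (simp add: chain_boundary_of numeral_2_eq_2)

lemma set_boundary_vertex_chain_1:
  "set_boundary (vertex_chain w (Suc 0) c) = vertex_chain w 0 (chain_boundary (Suc 0) c)"
proof -
  have "Poly_Mapping.keys c \<subseteq> UNIV" by simp
  then show ?thesis
  proof (induction c rule: frag_induction)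
    case (one g)
    show ?case
      by (simp add: vertex_chain_def chain_boundary_1_of frag_extend_diff vertex_tuple_expand
          singular_face_corner set_boundary_alt_pair)
  qed (simp_all add: vertex_chain_def chain_boundary_diff frag_extend_diff set_boundary_def)
qed

lemma set_boundary_vertex_chain_2:
  "set_boundary (vertex_chain w 2 c) = vertex_chain w (Suc 0) (chain_boundary 2 c)"
proof -
  have "Poly_Mapping.keys c \<subseteq> UNIV" by simp
  then show ?thesis
  proof (induction c rule: frag_induction)
    case (one g)
    show ?case
      by (simp add: vertex_chain_def chain_boundary_2_of frag_extend_diff frag_extend_add
          vertex_tuple_expand singular_face_corner set_boundary_alt_triple numeral_2_eq_2 [symmetric])
  qed (simp_all add: vertex_chain_def chain_boundary_diff frag_extend_diff set_boundary_def)
qed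

lemma set_boundary_prism0:
  "set_boundary (prism0 w w' c) = vertex_chain w' 0 c - vertex_chain w 0 c"
proof -
  have "Poly_Mapping.keys c \<subseteq> UNIV" by simp
  then show ?thesis
  proof (induction c rule: frag_induction)
    case (one g)
    show ?case
      by (simp add: vertex_chain_def prism0_def vertex_tuple_expand set_boundary_alt_pair)
  qed (simp_all add: vertex_chain_def prism0_def frag_extend_diff set_boundary_def)
qed

lemma set_boundary_diff: "set_boundary (a - b) = set_boundary a - set_boundary b"
  by (simp add: set_boundary_def frag_extend_diff)

text \<open>The prism over an edge is cut into \<open>[a, a', b']\<close> and
  \<open>[a, b, b']\<close>; the diagonal \<open>[a, b']\<close> cancels, which leaves top, bottom
  and the two sides.\<close>

lemma set_boundary_prism1:
  "set_boundary (prism1 w w' c) =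
     vertex_chain w' (Suc 0) c - vertex_chain w (Suc 0) c - prism0 w w' (chain_boundary (Suc 0) c)"
proof -
  have "Poly_Mapping.keys c \<subseteq> UNIV" by simp
  then show ?thesis
  proof (induction c rule: frag_induction)
    case (one g)
    show ?case
      by (simp add: vertex_chain_def prism0_def prism1_def vertex_tuple_expand chain_boundary_1_of
          frag_extend_diff singular_face_corner set_boundary_alt_triple set_boundary_diff)
  qed (simp_all add: vertex_chain_def prism0_def prism1_def chain_boundary_diff frag_extend_diff set_boundary_def)
qed

text \<open>The prism identity in degree 2, with the prism over a triangle taken to be 0. Its
  tetrahedra \<open>[a, a', b', c']\<close>, \<open>[a, b, b', c']\<close> and
  \<open>[a, b, c, c']\<close> have at most three distinct vertices, so their alternating boundaries
  vanish.\<close>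

lemma prism1_chain_boundary_2:
  assumes "\<And>g. g \<in> Poly_Mapping.keys c \<Longrightarrow>
    card (set (vertex_tuple w 2 g) \<union> set (vertex_tuple w' 2 g)) \<le> 3"
  shows "prism1 w w' (chain_boundary 2 c) = vertex_chain w' 2 c - vertex_chain w 2 c"
proof -
  have "Poly_Mapping.keys c \<subseteq> {g. card (set (vertex_tuple w 2 g) \<union> set (vertex_tuple w' 2 g)) \<le> 3}"
    using assms by auto
  then show ?thesis
  proof (induction c rule: frag_induction)
    case (one g)
    define a b c a' b' c' where abc: "a = w (g (\<lambda>i. if i = 0 then 1 else 0))"
      "b = w (g (\<lambda>i. if i = Suc 0 then 1 else 0))" "c = w (g (\<lambda>i. if i = 2 then 1 else 0))"
      "a' = w' (g (\<lambda>i. if i = 0 then 1 else 0))"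
      "b' = w' (g (\<lambda>i. if i = Suc 0 then 1 else 0))" "c' = w' (g (\<lambda>i. if i = 2 then 1 else 0))"
    have card3: "card {a, b, c, a', b', c'} \<le> 3"
      using one by (simp add: vertex_tuple_expand abc [symmetric] insert_commute)
    have degenerate: "\<not> distinct [p, q, r, s]" if "{p, q, r, s} \<subseteq> {a, b, c, a', b', c'}" for p q r s
    proof
      assume "distinct [p, q, r, s]"
      then have "card {p, q, r, s} = 4" by simp
      moreover have "card {p, q, r, s} \<le> card {a, b, c, a', b', c'}"
        using that by (intro card_mono) auto
      ultimately show False using card3 by simp
    qed
    have e: "alt_simplex [a', b', c'] - alt_simplex [a, b', c'] + alt_simplex [a, a', c'] - alt_simplex [a, a', b'] = 0"
      "alt_simplex [b, b', c'] - alt_simplex [a, b', c'] + alt_simplex [a, b, c'] - alt_simplex [a, b, b'] = 0"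
      "alt_simplex [b, c, c'] - alt_simplex [a, c, c'] + alt_simplex [a, b, c'] - alt_simplex [a, b, c] = 0"
      by (rule alt_boundary_degenerate_quadruple, rule degenerate, force)+
    \<comment> \<open>The prism takes its tetrahedra with signs +, -, +. The two sides of the claim
      differ by minus the boundary of that sum.\<close>
    have "((alt_simplex [b, b', c'] - alt_simplex [b, c, c'])
        - (alt_simplex [a, a', c'] - alt_simplex [a, c, c'])
        + (alt_simplex [a, a', b'] - alt_simplex [a, b, b']))
        - (alt_simplex [a', b', c'] - alt_simplex [a, b, c])
        = - (alt_simplex [a', b', c'] - alt_simplex [a, b', c'] + alt_simplex [a, a', c'] - alt_simplex [a, a', b'])
          + (alt_simplex [b, b', c'] - alt_simplex [a, b', c'] + alt_simplex [a, b, c'] - alt_simplex [a, b, b'])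
          - (alt_simplex [b, c, c'] - alt_simplex [a, c, c'] + alt_simplex [a, b, c'] - alt_simplex [a, b, c])"
      by (simp add: algebra_simps)
    then have "(alt_simplex [b, b', c'] - alt_simplex [b, c, c'])
        - (alt_simplex [a, a', c'] - alt_simplex [a, c, c'])
        + (alt_simplex [a, a', b'] - alt_simplex [a, b, b'])
        = alt_simplex [a', b', c'] - alt_simplex [a, b, c]"
      unfolding e by simp
    then show ?case
      by (simp add: vertex_chain_def prism1_def vertex_tuple_expand chain_boundary_2_of
          frag_extend_diff frag_extend_add singular_face_corner abc [symmetric] numeral_2_eq_2 [symmetric])
  qed (simp_all add: vertex_chain_def prism1_def chain_boundary_diff frag_extend_diff)
qed

section \<open>A Lefschetz argument for complexes of dimension two\<close>

text \<open>The sets \<open>U m\<close> play the role of the open stars of the vertices.\<close>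

locale star_cover =
  fixes K :: "int set set" and X :: "'a::metric_space set" and U :: "int \<Rightarrow> 'a set"
    and f :: "(int \<Rightarrow> real) \<Rightarrow> 'a"
  assumes finite_K: "finite K"
    and complex_K: "abstract_simplicial_complex K"
    and dim_K: "\<And>S. S \<in> K \<Longrightarrow> card S \<le> 3"
    and compact_X: "compact X"
    and open_U: "\<And>m. m \<in> \<Union>K \<Longrightarrow> openin (top_of_set X) (U m)"
    and cover_U: "X \<subseteq> (\<Union>m\<in>\<Union>K. U m)"
    and nerve_U: "\<And>S q. S \<subseteq> \<Union>K \<Longrightarrow> S \<noteq> {} \<Longrightarrow> q \<in> X \<Longrightarrow> (\<And>m. m \<in> S \<Longrightarrow> q \<in> U m) \<Longrightarrow> S \<in> K"
    and cont_f: "continuous_on (geometric_realization K) f"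
    and range_f: "f ` geometric_realization K \<subseteq> X"
    and carrier_f: "\<And>x m. x \<in> geometric_realization K \<Longrightarrow> m \<in> \<Union>K \<Longrightarrow> f x \<in> U m \<Longrightarrow> x m \<noteq> 0"
begin

lemma finite_simplex: "S \<in> K \<Longrightarrow> finite S" and nonempty_simplex: "S \<in> K \<Longrightarrow> S \<noteq> {}"
  using complex_K by (auto simp: abstract_simplicial_complex_def)

lemma card_simplex_pos: "S \<in> K \<Longrightarrow> 0 < card S"
  by (simp add: card_gt_0_iff finite_simplex nonempty_simplex)

lemma face_in_K: "S \<in> K \<Longrightarrow> T \<subseteq> S \<Longrightarrow> T \<noteq> {} \<Longrightarrow> T \<in> K"
  using complex_K unfolding abstract_simplicial_complex_def by blast

definition cell :: "int set \<Rightarrow> 'a set" where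
  "cell S = f ` {x \<in> geometric_realization K. {v. x v \<noteq> 0} \<subseteq> S}"

definition fine_chain :: "nat \<Rightarrow> int set \<Rightarrow> 'a chain" where
  "fine_chain m S = (singular_subdivision (card S - 1) ^^ m) (frag_of (realize_simplex f S))"

lemma cell_subset: "cell S \<subseteq> X"
  using range_f by (auto simp: cell_def)

lemma singular_chain_realize: "S \<in> K \<Longrightarrow> singular_chain (card S - 1) (top_of_set (cell S)) (frag_of (realize_simplex f S))"
  unfolding singular_chain_of cell_def by (rule singular_simplex_realize [OF complex_K _ cont_f])

lemma fine_chain_corner:
  assumes "S \<in> K" "g \<in> Poly_Mapping.keys (fine_chain m S)" "j \<le> card S - 1"
  shows "g (\<lambda>i. if i = j then 1 else 0) \<in> cell S"
proof -
  have "singular_chain (card S - 1) (top_of_set (cell S)) (fine_chain m S)"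
    unfolding fine_chain_def by (rule singular_chain_subdivision_power [OF singular_chain_realize [OF assms(1)]])
  then have "singular_simplex (card S - 1) (top_of_set (cell S)) g"
    using assms(2) by (auto simp: singular_chain_def)
  then have "g \<in> standard_simplex (card S - 1) \<rightarrow> cell S"
    by (auto simp: singular_simplex_def continuous_map_def Pi_iff)
  then show ?thesis
    using assms(3) by (auto simp: Pi_iff)
qed

text \<open>Realization and subdivision both commute with the boundary, so
  \<open>fine_chain m\<close> is a chain map from simplicial to singular chains.\<close>

lemma chain_boundary_fine_chain:
  assumes "S \<in> K" "2 \<le> card S"
  shows "chain_boundary (card S - 1) (fine_chain m S) = frag_extend (fine_chain m) (set_boundary (frag_of S))"
proof -
  have "card (S - {s}) - 1 = card S - 1 - Suc 0" if "s \<in> S" for s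
    using that finite_simplex [OF assms(1)] by simp
  then show ?thesis
    unfolding fine_chain_def chain_boundary_subdivision_power [OF singular_chain_realize [OF assms(1)]]
      chain_boundary_realize [OF finite_simplex [OF assms(1)] assms(2)]
    by (simp add: singular_subdivision_power_sum singular_subdivision_power_cmul set_boundary_def
        frag_extend_sum frag_extend_cmul finite_simplex assms(1) o_def fine_chain_def cong: sum.cong)
qed

lemma set_vertex_tuple_subset:
  assumes "S \<in> K" "g \<in> Poly_Mapping.keys (fine_chain m S)" "\<And>q. q \<in> cell S \<Longrightarrow> w q \<in> A"
  shows "set (vertex_tuple w (card S - 1) g) \<subseteq> A"
  using fine_chain_corner [OF assms(1,2)] assms(3) by (auto simp: vertex_tuple_def)

text \<open>An algebraic form of Sperner's lemma. Corners of pieces lie in \<open>cell S\<close>, so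
  \<open>carrier_f\<close> forces their labels into \<open>S\<close>, and the labelled chain is a
  multiple of \<open>S\<close>. The factor is 1 in dimension 0 because subdivision does nothing
  there, and in higher dimension because the boundary is correct by the previous dimension and is
  nonzero.\<close>

lemma vertex_chain_fine_chain:
  assumes w: "\<And>q. q \<in> X \<Longrightarrow> w q \<in> \<Union>K \<and> q \<in> U (w q)" and "S \<in> K"
  shows "vertex_chain w (card S - 1) (fine_chain m S) = frag_of S"
proof -
  have carried: "\<exists>a. vertex_chain w (card S - 1) (fine_chain m S) = frag_cmul a (frag_of S)" if "S \<in> K" for S
  proof -
    have "Poly_Mapping.keys (vertex_chain w (card S - 1) (fine_chain m S)) \<subseteq> {S}"
    proof -
      have "Poly_Mapping.keys (alt_simplex (vertex_tuple w (card S - 1) g)) \<subseteq> {S}"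
        if g: "g \<in> Poly_Mapping.keys (fine_chain m S)" for g
      proof (cases "distinct (vertex_tuple w (card S - 1) g)")
        case True
        have "set (vertex_tuple w (card S - 1) g) \<subseteq> S"
        proof (rule set_vertex_tuple_subset [OF \<open>S \<in> K\<close> g])
          fix q assume q: "q \<in> cell S"
          then obtain x where x: "x \<in> geometric_realization K" "{v. x v \<noteq> 0} \<subseteq> S" "q = f x"
            by (auto simp: cell_def)
          have "q \<in> X"
            using q cell_subset by blast
          then show "w q \<in> S"
            using w [of q] carrier_f [OF x(1), of "w q"] x by auto
        qed
        moreover have "card (set (vertex_tuple w (card S - 1) g)) = card S"
          using True card_simplex_pos [OF \<open>S \<in> K\<close>] by (simp add: distinct_card) (simp add: vertex_tuple_def)
        ultimately have "set (vertex_tuple w (card S - 1) g) = S"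
          using finite_simplex [OF \<open>S \<in> K\<close>] card_subset_eq by blast
        then show ?thesis by (simp add: keys_alt_simplex)
      qed (simp add: keys_alt_simplex)
      then show ?thesis
        unfolding vertex_chain_def by (intro order_trans [OF keys_frag_extend] UN_least)
    qed
    then have "vertex_chain w (card S - 1) (fine_chain m S) =
        frag_cmul (Poly_Mapping.lookup (vertex_chain w (card S - 1) (fine_chain m S)) S) (frag_of S)"
    proof (intro poly_mapping_eqI)
      fix T
      show "Poly_Mapping.lookup (vertex_chain w (card S - 1) (fine_chain m S)) T =
        Poly_Mapping.lookup (frag_cmul (Poly_Mapping.lookup (vertex_chain w (card S - 1) (fine_chain m S)) S) (frag_of S)) T"
      proof (cases "T = S")
        case False
        then have "T \<notin> Poly_Mapping.keys (vertex_chain w (card S - 1) (fine_chain m S))"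
          using \<open>Poly_Mapping.keys (vertex_chain w (card S - 1) (fine_chain m S)) \<subseteq> {S}\<close> by blast
        with False show ?thesis by (simp add: in_keys_iff)
      qed simp
    qed
    then show ?thesis by blast
  qed
  have ext: "vertex_chain w p (frag_extend (fine_chain m) c) = frag_extend (vertex_chain w p \<circ> fine_chain m) c" for p c
    by (simp add: vertex_chain_def frag_extend_frag_extend o_def)
  have dim0: "vertex_chain w 0 (fine_chain m S) = frag_of S" if S: "S \<in> K" "card S = 1" for S
  proof -
    have "(singular_subdivision 0 ^^ k) (frag_of (realize_simplex f S)) = frag_of (realize_simplex f S)" for k
      using singular_chain_realize [OF S(1)] S(2) by (induction k) (auto simp: singular_subdivision_zero)
    then have eq: "fine_chain m S = frag_of (realize_simplex f S)"
      by (simp add: fine_chain_def S)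
    obtain b where b: "vertex_chain w 0 (fine_chain m S) = frag_cmul b (frag_of S)"
      using carried [OF S(1)] S by auto
    define c where "c = w (realize_simplex f S (\<lambda>i. if i = 0 then 1 else 0))"
    have c: "vertex_chain w 0 (fine_chain m S) = frag_of {c}"
      unfolding eq by (simp add: c_def vertex_chain_def vertex_tuple_expand alt_simplex_def)
    \<comment> \<open>The coefficient at \<open>{c}\<close> is 1 on the right; it could not be
      nonzero on the left unless \<open>S\<close> were \<open>{c}\<close>.\<close>
    have "Poly_Mapping.lookup (frag_cmul b (frag_of S)) {c} = Poly_Mapping.lookup (frag_of {c}) {c}"
      unfolding b [symmetric] c ..
    then have "S = {c}"
      by (simp split: if_splits)
    then show ?thesis
      using c by simp
  qed
  have step: "vertex_chain w p (fine_chain m S) = frag_of S"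
    if S: "S \<in> K" "card S = Suc p" "0 < p"
      and comm: "set_boundary (vertex_chain w p (fine_chain m S)) = vertex_chain w (p - 1) (chain_boundary p (fine_chain m S))"
      and IH: "\<And>T. T \<in> K \<Longrightarrow> card T = p \<Longrightarrow> vertex_chain w (p - 1) (fine_chain m T) = frag_of T" for S p
  proof -
    obtain a where a: "vertex_chain w p (fine_chain m S) = frag_cmul a (frag_of S)"
      using carried [OF S(1)] S by auto
    have "set_boundary (vertex_chain w p (fine_chain m S))
        = frag_extend (vertex_chain w (p - 1) \<circ> fine_chain m) (set_boundary (frag_of S))"
      using chain_boundary_fine_chain [OF S(1), of m] S comm by (simp add: ext)
    also have "\<dots> = frag_extend frag_of (set_boundary (frag_of S))"
    proof (rule frag_extend_eq)
      fix T assume "T \<in> Poly_Mapping.keys (set_boundary (frag_of S))"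
      then obtain s where s: "s \<in> S" "T = S - {s}"
        using keys_set_boundary_frag_of by blast
      then have "card T = p"
        using S finite_simplex [OF S(1)] by simp
      moreover have "T \<noteq> {}" using \<open>card T = p\<close> \<open>0 < p\<close> by auto
      ultimately show "(vertex_chain w (p - 1) \<circ> fine_chain m) T = frag_of T"
        using IH [of T] face_in_K [OF S(1), of T] s by auto
    qed
    also have "\<dots> = set_boundary (frag_of S)"
      by (rule frag_expansion [symmetric])
    finally have "frag_cmul (a - 1) (set_boundary (frag_of S)) = 0"
      unfolding a by (simp add: set_boundary_def frag_extend_cmul frag_cmul_diff_distrib)
    then have "a = 1"
      using set_boundary_nonzero finite_simplex nonempty_simplex S(1) by auto
    with a show ?thesis by simp
  qed
  have dim1: "vertex_chain w (Suc 0) (fine_chain m S) = frag_of S" if "S \<in> K" "card S = 2" for S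
    by (rule step) (use that dim0 in \<open>auto simp: set_boundary_vertex_chain_1\<close>)
  have dim2: "vertex_chain w 2 (fine_chain m S) = frag_of S" if "S \<in> K" "card S = 3" for S
    by (rule step) (use that dim1 in \<open>auto simp: set_boundary_vertex_chain_2\<close>)
  have "card S = 1 \<or> card S = 2 \<or> card S = 3"
    using dim_K [OF \<open>S \<in> K\<close>] card_simplex_pos [OF \<open>S \<in> K\<close>] by linarith
  then show ?thesis
    using dim0 dim1 dim2 \<open>S \<in> K\<close> by (auto simp: numeral_2_eq_2)
qed

text \<open>Labels that all avoid \<open>S\<close> cannot have \<open>S\<close> as their set. This
  gives the zero diagonal at the end of the homotopy.\<close>

lemma lookup_vertex_chain_fine_chain_eq_0:
  assumes S: "S \<in> K" and w: "\<And>q. q \<in> cell S \<Longrightarrow> w q \<notin> S"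
  shows "Poly_Mapping.lookup (vertex_chain w (card S - 1) (fine_chain m S)) S = 0"
proof -
  have "S \<notin> Poly_Mapping.keys (alt_simplex (vertex_tuple w (card S - 1) g))"
    if g: "g \<in> Poly_Mapping.keys (fine_chain m S)" for g
  proof -
    have "set (vertex_tuple w (card S - 1) g) \<subseteq> - S"
      by (rule set_vertex_tuple_subset [OF S g]) (use w in auto)
    then have "set (vertex_tuple w (card S - 1) g) \<noteq> S"
      using nonempty_simplex [OF S] by auto
    then show ?thesis by (auto simp: keys_alt_simplex)
  qed
  then have "S \<notin> Poly_Mapping.keys (vertex_chain w (card S - 1) (fine_chain m S))"
    unfolding vertex_chain_def
    using keys_frag_extend [of "\<lambda>g. alt_simplex (vertex_tuple w (card S - 1) g)" "fine_chain m S"] by blast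
  then show ?thesis by (simp add: in_keys_iff)
qed

lemma fine_subdivision_exists:
  assumes "0 < e"
  obtains m where "\<And>S g j k. \<lbrakk>S \<in> K; g \<in> Poly_Mapping.keys (fine_chain m S); j \<le> card S - 1; k \<le> card S - 1\<rbrakk>
    \<Longrightarrow> dist (g (\<lambda>i. if i = j then 1 else 0)) (g (\<lambda>i. if i = k then 1 else 0)) < e"
proof -
  have "\<exists>n. \<forall>m g. n \<le> m \<longrightarrow> g \<in> Poly_Mapping.keys (fine_chain m S)
      \<longrightarrow> (\<exists>q. g \<in> standard_simplex (card S - 1) \<rightarrow> ball q (e / 2))" if S: "S \<in> K" for S
  proof -
    have chain: "singular_chain (card S - 1) (top_of_set X) (frag_of (realize_simplex f S))"
      using singular_chain_realize [OF S] cell_subset singular_chain_mono [of _ euclidean] by blast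
    obtain n where "\<And>m g. \<lbrakk>n \<le> m; g \<in> Poly_Mapping.keys ((singular_subdivision (card S - 1) ^^ m) (frag_of (realize_simplex f S)))\<rbrakk>
        \<Longrightarrow> \<exists>V \<in> (\<lambda>q. X \<inter> ball q (e / 2)) ` X. g \<in> standard_simplex (card S - 1) \<rightarrow> V"
    proof (rule sufficient_iterated_singular_subdivision_exists [OF _ _ chain])
      show "openin (top_of_set X) V" if "V \<in> (\<lambda>q. X \<inter> ball q (e / 2)) ` X" for V
        using that by (auto intro: openin_open_Int)
      show "topspace (top_of_set X) \<subseteq> \<Union> ((\<lambda>q. X \<inter> ball q (e / 2)) ` X)"
        using assms by auto
    qed blast
    then show ?thesis
      unfolding fine_chain_def by (intro exI [of _ n]) blast
  qed
  then obtain n where n: "\<And>S m g. \<lbrakk>S \<in> K; n S \<le> m; g \<in> Poly_Mapping.keys (fine_chain m S)\<rbrakk>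
      \<Longrightarrow> \<exists>q. g \<in> standard_simplex (card S - 1) \<rightarrow> ball q (e / 2)"
    by metis
  \<comment> \<open>Each threshold \<open>n S\<close> is valid for all larger numbers of
    subdivisions, so the sum of the finitely many thresholds serves every simplex at once.\<close>
  show ?thesis
  proof
    fix S g j k
    assume A: "S \<in> K" "g \<in> Poly_Mapping.keys (fine_chain (sum n K) S)" "j \<le> card S - 1" "k \<le> card S - 1"
    have "n S \<le> sum n K"
      using A(1) finite_K by (simp add: member_le_sum)
    then obtain q where q: "g \<in> standard_simplex (card S - 1) \<rightarrow> ball q (e / 2)"
      using n A by blast
    have "g (\<lambda>i. if i = j then 1 else 0) \<in> ball q (e / 2)" "g (\<lambda>i. if i = k then 1 else 0) \<in> ball q (e / 2)"
      using q A(3,4) by (auto simp: Pi_iff simp del: mem_ball)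
    then show "dist (g (\<lambda>i. if i = j then 1 else 0)) (g (\<lambda>i. if i = k then 1 else 0)) < e"
      by (metis dist_triangle_half_r mem_ball)
  qed
qed

text \<open>A weak form of the Lefschetz fixed point theorem: the self-map only has to move every cell
  off the stars of its own vertices.\<close>

theorem euler_characteristic_eq_0:
  fixes H :: "real \<times> 'a \<Rightarrow> 'a"
  assumes contH: "continuous_on ({0..1} \<times> X) H" and rangeH: "H ` ({0..1} \<times> X) \<subseteq> X"
    and H0: "\<And>q. q \<in> X \<Longrightarrow> H (0, q) = q"
    and free: "\<And>S x m. \<lbrakk>S \<in> K; x \<in> geometric_realization K; {v. x v \<noteq> 0} \<subseteq> S; m \<in> S\<rbrakk>
      \<Longrightarrow> H (1, f x) \<notin> U m"
  shows "int (card (n_simplices 0 K)) - int (card (n_simplices 1 K)) + int (card (n_simplices 2 K)) = 0"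
proof -
  \<comment> \<open>The stars are open only relative to \<open>X\<close>; \<open>\<G>\<close>
    collects their open extensions to the whole space, to which \<open>Heine_Borel_lemma\<close>
    applies.\<close>
  define \<G> where "\<G> = {G. open G \<and> (\<exists>m\<in>\<Union>K. U m = X \<inter> G)}"
  have "X \<subseteq> \<Union>\<G>"
  proof
    fix q assume "q \<in> X"
    then have "q \<in> (\<Union>m\<in>\<Union>K. U m)"
      using cover_U by (rule subsetD [rotated])
    then obtain m where m: "m \<in> \<Union>K" "q \<in> U m"
      by (rule UN_E)
    then obtain G where "open G" "U m = X \<inter> G"
      using open_U [OF m(1)] by (auto simp: openin_open)
    then show "q \<in> \<Union>\<G>"
      using m unfolding \<G>_def by blast
  qed
  moreover have "open G" if "G \<in> \<G>" for G
    using that by (simp add: \<G>_def)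
  ultimately obtain e where e: "0 < e" "\<And>q. q \<in> X \<Longrightarrow> \<exists>G\<in>\<G>. ball q e \<subseteq> G"
    using Heine_Borel_lemma [OF compact_X, of \<G>] by metis
  have "\<exists>m\<in>\<Union>K. X \<inter> ball q e \<subseteq> U m" if "q \<in> X" for q
    using e(2) [OF that] unfolding \<G>_def by blast
  \<comment> \<open>\<open>e\<close> is a Lebesgue number of the star cover. The star of
    \<open>v q\<close> contains not just \<open>q\<close> but its whole \<open>e\<close>-ball in
    \<open>X\<close>, and this slack absorbs one step of the homotopy.\<close>
  then obtain v where v: "\<And>q. q \<in> X \<Longrightarrow> v q \<in> \<Union>K \<and> X \<inter> ball q e \<subseteq> U (v q)"
    by metis
  have "uniformly_continuous_on ({0..1} \<times> X) H"
    by (intro compact_uniformly_continuous contH compact_Times compact_X) auto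
  then obtain d where d: "0 < d" "\<And>y z. \<lbrakk>y \<in> {0..1} \<times> X; z \<in> {0..1} \<times> X; dist z y < d\<rbrakk> \<Longrightarrow> dist (H z) (H y) < e"
    using e(1) unfolding uniformly_continuous_on_def by metis
  \<comment> \<open>Half of \<open>d\<close> is spent on the time step, the other half on the
    diameter of a piece.\<close>
  obtain M :: nat where M: "0 < M" "1 / real M < d / 2"
    using d(1) by (metis half_gt_zero nat_approx_posE zero_less_Suc of_nat_Suc)
  obtain m where m: "\<And>S g j k. \<lbrakk>S \<in> K; g \<in> Poly_Mapping.keys (fine_chain m S); j \<le> card S - 1; k \<le> card S - 1\<rbrakk>
    \<Longrightarrow> dist (g (\<lambda>i. if i = j then 1 else 0)) (g (\<lambda>i. if i = k then 1 else 0)) < d / 2"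
    using fine_subdivision_exists [of "d / 2"] d(1) by auto
  define w where "w = (\<lambda>k q. v (H (real k / real M, q)))"
  have HX: "H (real k / real M, q) \<in> X" if "k \<le> M" "q \<in> X" for k q
    using rangeH that M(1) by (auto simp: image_subset_iff)
  \<comment> \<open>Contiguity: at two consecutive times all corners of a piece have images within
    \<open>e\<close> of the single point \<open>q\<close>. So \<open>q\<close> lies in every star
    chosen for them, and \<open>nerve_U\<close> makes the chosen vertices one simplex.\<close>
  have common: "set (vertex_tuple (w k) (card S - 1) g) \<union> set (vertex_tuple (w (Suc k)) (card S - 1) g) \<in> K"
    if S: "S \<in> K" and g: "g \<in> Poly_Mapping.keys (fine_chain m S)" and k: "k < M" for S g k
  proof -
    define c where "c = (\<lambda>j. g (\<lambda>i. if i = j then 1 else 0))"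
    have cX: "c j \<in> X" if "j \<le> card S - 1" for j
      using fine_chain_corner [OF S g that] cell_subset by (auto simp: c_def)
    define q where "q = H (real k / real M, c 0)"
    have close: "v (H (real k' / real M, c j)) \<in> \<Union>K \<and> q \<in> U (v (H (real k' / real M, c j)))"
      if "k' = k \<or> k' = Suc k" "j \<le> card S - 1" for k' j
    proof -
      have "\<bar>real k / real M - real k' / real M\<bar> \<le> 1 / real M"
        using that(1) M(1) by (auto simp: field_simps)
      then have "dist (real k / real M) (real k' / real M) < d / 2"
        using M(2) by (simp add: dist_real_def)
      moreover have "dist (c 0) (c j) < d / 2"
        unfolding c_def using m [OF S g] that(2) by blast
      moreover have "dist (real k / real M, c 0) (real k' / real M, c j)
          \<le> dist (real k / real M) (real k' / real M) + dist (c 0) (c j)"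
        unfolding dist_Pair_Pair by (rule sqrt_sum_squares_le_sum) auto
      ultimately have "dist (real k / real M, c 0) (real k' / real M, c j) < d"
        by linarith
      moreover have "(real k / real M, c 0) \<in> {0..1} \<times> X" "(real k' / real M, c j) \<in> {0..1} \<times> X"
        using that k cX M(1) by auto
      ultimately have "dist q (H (real k' / real M, c j)) < e"
        unfolding q_def using d(2) by blast
      moreover have "q \<in> X" "H (real k' / real M, c j) \<in> X"
        unfolding q_def by (rule HX; use that k cX in auto)+
      ultimately show ?thesis
        using v [of "H (real k' / real M, c j)"] by (auto simp: dist_commute)
    qed
    have sets: "set (vertex_tuple (w k') (card S - 1) g) = (\<lambda>j. v (H (real k' / real M, c j))) ` {..card S - 1}" for k'
      by (simp add: vertex_tuple_def w_def c_def atLeast0LessThan lessThan_Suc_atMost del: upt_Suc)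
    show ?thesis
      unfolding sets
    proof (rule nerve_U)
      show "q \<in> X"
        unfolding q_def using k cX HX by auto
    qed (use close [of k] close [of "Suc k"] in auto)
  qed
  have w0: "w 0 q \<in> \<Union>K \<and> q \<in> U (w 0 q)" if "q \<in> X" for q
    using v [OF that] H0 [OF that] that e(1) by (auto simp: w_def)
  \<comment> \<open>The star of \<open>w M q\<close> contains the moved point, while by
    \<open>free\<close> the moved point lies in no star of a vertex of \<open>S\<close>.\<close>
  have wM: "w M q \<notin> S" if "S \<in> K" "q \<in> cell S" for S q
  proof
    assume in_S: "w M q \<in> S"
    obtain x where x: "x \<in> geometric_realization K" "{v. x v \<noteq> 0} \<subseteq> S" "q = f x"
      using \<open>q \<in> cell S\<close> by (auto simp: cell_def)
    have "q \<in> X"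
      using that(2) cell_subset by blast
    then have "H (1, q) \<in> X"
      using HX [of M q] M(1) by simp
    then have "H (1, q) \<in> U (w M q)"
      using v [of "H (1, q)"] e(1) M(1) by (auto simp: w_def)
    then show False
      using free [OF that(1) x(1,2) in_S] x(3) by simp
  qed
  \<comment> \<open>The homotopy operator adds the prisms over all time steps; its boundary formula
    telescopes to the final vertex choice minus the initial one.\<close>
  define D0 where "D0 = (\<lambda>S. \<Sum>k<M. prism0 (w k) (w (Suc k)) (fine_chain m S))"
  define D1 where "D1 = (\<lambda>S. \<Sum>k<M. prism1 (w k) (w (Suc k)) (fine_chain m S))"
  have bd_sum: "set_boundary (\<Sum>k\<in>I. c k) = (\<Sum>k\<in>I. set_boundary (c k))" for I :: "nat set" and c
    by (induction I rule: infinite_finite_induct) (auto simp: set_boundary_def frag_extend_add)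
  have ext_sum: "frag_extend (\<lambda>S. \<Sum>k\<in>I. F k S) c = (\<Sum>k\<in>I. frag_extend (F k) c)"
    for I :: "nat set" and F :: "nat \<Rightarrow> int set \<Rightarrow> int set \<Rightarrow>\<^sub>0 int" and c
    by (simp add: frag_extend_def frag_cmul_sum sum.swap [of _ I])
  have ext0: "frag_extend D0 c = (\<Sum>k<M. prism0 (w k) (w (Suc k)) (frag_extend (fine_chain m) c))" for c
    unfolding D0_def ext_sum
    by (simp add: prism0_def frag_extend_frag_extend o_def)
  have ext1: "frag_extend D1 c = (\<Sum>k<M. prism1 (w k) (w (Suc k)) (frag_extend (fine_chain m) c))" for c
    unfolding D1_def ext_sum
    by (simp add: prism1_def frag_extend_frag_extend o_def)
  have telescope: "(\<Sum>k<M. vertex_chain (w (Suc k)) p c - vertex_chain (w k) p c)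
      = vertex_chain (w M) p c - vertex_chain (w 0) p c" for p c
    by (rule sum_lessThan_telescope)
  \<comment> \<open>The final choice contributes 0 because it moves cells off their stars; the
    initial one is the identity and contributes 1.\<close>
  have trace: "Poly_Mapping.lookup (vertex_chain (w M) p (fine_chain m S) - vertex_chain (w 0) p (fine_chain m S)) S = -1"
    if "S \<in> K" "card S = Suc p" for S p
    using vertex_chain_fine_chain [of "w 0" S m] w0 that
      lookup_vertex_chain_fine_chain_eq_0 [of S "w M" m] wM
    by (simp add: lookup_minus)
  have faces: "Poly_Mapping.keys (set_boundary (frag_of S)) \<subseteq> n_simplices n K"
    if "S \<in> n_simplices (Suc n) K" for S n
  proof
    fix T assume "T \<in> Poly_Mapping.keys (set_boundary (frag_of S))"
    then obtain s where s: "s \<in> S" "T = S - {s}"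
      using keys_set_boundary_frag_of by blast
    have S: "S \<in> K" "card S = Suc (Suc n)" using that by (auto simp: n_simplices_def)
    then have "card T = Suc n"
      using s finite_simplex by simp
    moreover from this have "T \<noteq> {}" by auto
    ultimately show "T \<in> n_simplices n K"
      using face_in_K [OF S(1)] s by (auto simp: n_simplices_def)
  qed
  have alt_keys: "Poly_Mapping.keys (alt_simplex vs) \<subseteq> n_simplices n K"
    if "S \<in> K" "g \<in> Poly_Mapping.keys (fine_chain m S)" "k < M" "length vs = Suc n"
      "set vs \<subseteq> set (vertex_tuple (w k) (card S - 1) g) \<union> set (vertex_tuple (w (Suc k)) (card S - 1) g)"
    for S g k n vs
  proof -
    have "set vs \<in> K"
      by (rule face_in_K [OF common [OF that(1-3)] that(5)]) (use that(4) in auto)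
    then show ?thesis
      using that(4) by (auto simp: keys_alt_simplex n_simplices_def distinct_card)
  qed
  show ?thesis
  proof (rule supertrace_commutator_zero)
    show "finite (n_simplices 0 K)" "finite (n_simplices 1 K)" "finite (n_simplices 2 K)"
      using finite_K by (auto simp: n_simplices_def)
    show "Poly_Mapping.keys (set_boundary (frag_of S)) \<subseteq> n_simplices 0 K" if "S \<in> n_simplices 1 K" for S
      using faces [of S 0] that by simp
    show "Poly_Mapping.keys (set_boundary (frag_of S)) \<subseteq> n_simplices 1 K" if "S \<in> n_simplices 2 K" for S
      using faces [of S 1] that by (simp add: numeral_2_eq_2)
    show "Poly_Mapping.keys (D0 S) \<subseteq> n_simplices 1 K" if "S \<in> n_simplices 0 K" for S
      unfolding D0_def prism0_def vertex_tuple_expand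
    proof (intro order_trans [OF keys_sum] UN_least order_trans [OF keys_frag_extend], simp only: prod.case list.case)
      fix k g assume "k \<in> {..<M}" "g \<in> Poly_Mapping.keys (fine_chain m S)"
      then show "Poly_Mapping.keys (alt_simplex [w k (g (\<lambda>i. if i = 0 then 1 else 0)),
          w (Suc k) (g (\<lambda>i. if i = 0 then 1 else 0))]) \<subseteq> n_simplices 1 K"
        using that by (intro alt_keys [of S g k]) (auto simp: n_simplices_def vertex_tuple_expand)
    qed
    show "Poly_Mapping.keys (D1 S) \<subseteq> n_simplices 2 K" if "S \<in> n_simplices 1 K" for S
      unfolding D1_def prism1_def One_nat_def vertex_tuple_expand
    proof (intro order_trans [OF keys_sum] UN_least order_trans [OF keys_frag_extend],
        simp only: prod.case list.case, intro order_trans [OF keys_diff] Un_least)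
      fix k g assume "k \<in> {..<M}" "g \<in> Poly_Mapping.keys (fine_chain m S)"
      then show "Poly_Mapping.keys (alt_simplex [w k (g (\<lambda>i. if i = 0 then 1 else 0)),
          w (Suc k) (g (\<lambda>i. if i = 0 then 1 else 0)), w (Suc k) (g (\<lambda>i. if i = Suc 0 then 1 else 0))])
          \<subseteq> n_simplices 2 K"
        "Poly_Mapping.keys (alt_simplex [w k (g (\<lambda>i. if i = 0 then 1 else 0)),
          w k (g (\<lambda>i. if i = Suc 0 then 1 else 0)), w (Suc k) (g (\<lambda>i. if i = Suc 0 then 1 else 0))])
          \<subseteq> n_simplices 2 K"
        using that by (intro alt_keys [of S g k]; auto simp: n_simplices_def vertex_tuple_expand)+
    qed
    show "Poly_Mapping.lookup (set_boundary (D0 S)) S = - 1" if "S \<in> n_simplices 0 K" for S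
      using that trace [of S 0] 
      by (simp add: D0_def bd_sum set_boundary_prism0 telescope n_simplices_def)
    show "Poly_Mapping.lookup (set_boundary (D1 S) + frag_extend D0 (set_boundary (frag_of S))) S = - 1"
      if "S \<in> n_simplices 1 K" for S
    proof -
      have S: "S \<in> K" "card S = 2" using that by (auto simp: n_simplices_def)
      have "set_boundary (D1 S) + frag_extend D0 (set_boundary (frag_of S))
          = (\<Sum>k<M. vertex_chain (w (Suc k)) (Suc 0) (fine_chain m S) - vertex_chain (w k) (Suc 0) (fine_chain m S))"
        using chain_boundary_fine_chain [of S m] S
        by (simp add: ext0 D1_def bd_sum set_boundary_prism1 sum_subtractf)
      then show ?thesis
        using trace [of S "Suc 0"] S by (simp add: telescope)
    qed
    show "Poly_Mapping.lookup (frag_extend D1 (set_boundary (frag_of S))) S = - 1"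
      if "S \<in> n_simplices 2 K" for S
    proof -
      have S: "S \<in> K" "card S = 3" using that by (auto simp: n_simplices_def)
      \<comment> \<open>By \<open>common\<close> the vertices of both choices form one simplex,
        hence number at most three. This is why the operator has no part in degree 2.\<close>
      have "prism1 (w k) (w (Suc k)) (chain_boundary 2 (fine_chain m S))
          = vertex_chain (w (Suc k)) 2 (fine_chain m S) - vertex_chain (w k) 2 (fine_chain m S)" if "k < M" for k
      proof (rule prism1_chain_boundary_2)
        fix g assume "g \<in> Poly_Mapping.keys (fine_chain m S)"
        then show "card (set (vertex_tuple (w k) 2 g) \<union> set (vertex_tuple (w (Suc k)) 2 g)) \<le> 3"
          using dim_K [OF common [OF S(1) _ that]] S by simp
      qed
      then have "frag_extend D1 (set_boundary (frag_of S))
          = (\<Sum>k<M. vertex_chain (w (Suc k)) 2 (fine_chain m S) - vertex_chain (w k) 2 (fine_chain m S))"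
        using chain_boundary_fine_chain [of S m] S by (simp add: ext1)
      then show ?thesis
        using trace [of S 2] S by (simp add: telescope)
    qed
  qed
qed

end

section \<open>The double cover of a triangulated torus\<close>

text \<open>The double cover is \<open>sq (z, w) = (z\<^sup>2, w)\<close>. The open star of \<open>v\<close> is \<open>{p. g p v \<noteq> 0}\<close> and \<open>rt v\<close> is a
  branch of the square root of the first coordinate on it, so that the star has exactly two lifts. They are
  indexed by the integers \<open>e v\<close> and \<open>- e v\<close>, and the lifted complex \<open>L\<close> is the nerve of all the lifts.\<close>

locale torus_double_cover =
  fixes K :: "'v set set" and h :: "('v \<Rightarrow> real) \<Rightarrow> complex \<times> complex"
    and g :: "complex \<times> complex \<Rightarrow> 'v \<Rightarrow> real"
    and e :: "'v \<Rightarrow> int" and rt :: "'v \<Rightarrow> complex \<times> complex \<Rightarrow> complex"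
  assumes finite_K: "finite K"
    and complex_K: "abstract_simplicial_complex K"
    and dim_K: "\<And>S. S \<in> K \<Longrightarrow> card S \<le> 3"
    and homeo: "homeomorphism (geometric_realization K) torus h g"
    and inj_e: "inj_on e (\<Union>K)"
    and e_pos: "\<And>v. 0 < e v"
    and cont_rt: "\<And>v. v \<in> \<Union>K \<Longrightarrow> continuous_on {p \<in> torus. g p v \<noteq> 0} (rt v)"
    and rt_square: "\<And>v p. \<lbrakk>v \<in> \<Union>K; p \<in> torus; g p v \<noteq> 0\<rbrakk> \<Longrightarrow> (rt v p)\<^sup>2 = fst p"
    and connected_stars: "\<And>u v. connected {p \<in> torus. g p u \<noteq> 0 \<and> g p v \<noteq> 0}"
begin

definition sq :: "complex \<times> complex \<Rightarrow> complex \<times> complex" where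
  "sq q = ((fst q)\<^sup>2, snd q)"

text \<open>The sign of \<open>m\<close> selects the sheet. Since \<open>e\<close> is positive and
  injective on vertices, \<open>m\<close> determines \<open>v\<close>, as \<open>U_vertex\<close>
  records.\<close>

definition U :: "int \<Rightarrow> (complex \<times> complex) set" where
  "U m = {q \<in> torus. \<exists>v\<in>\<Union>K. \<bar>m\<bar> = e v \<and> g (sq q) v \<noteq> 0 \<and> fst q = of_int (sgn m) * rt v (sq q)}"

definition L :: "int set set" where
  "L = {S. S \<noteq> {} \<and> (\<exists>q\<in>torus. \<forall>m\<in>S. q \<in> U m)}"

text \<open>The covering projection on vertex sets: it forgets the sheet.\<close>

definition shadow :: "int set \<Rightarrow> 'v set" where
  "shadow S = {v \<in> \<Union>K. e v \<in> S \<or> - e v \<in> S}"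

lemma finite_vertices: "finite (\<Union>K)"
  using finite_K complex_K by (auto simp: abstract_simplicial_complex_def)

lemma sq_in_torus: "q \<in> torus \<Longrightarrow> sq q \<in> torus"
  by (auto simp: torus_def sq_def norm_power mem_Times_iff)

lemma continuous_on_sq: "continuous_on A sq"
  unfolding sq_def by (intro continuous_intros)

lemma g_in: "p \<in> torus \<Longrightarrow> g p \<in> geometric_realization K"
  and h_in: "x \<in> geometric_realization K \<Longrightarrow> h x \<in> torus"
  and g_h: "x \<in> geometric_realization K \<Longrightarrow> g (h x) = x"
  and cont_h: "continuous_on (geometric_realization K) h"
  and cont_g: "continuous_on torus g"
  using homeo by (auto simp: homeomorphism_def)

lemma support_in_K: "p \<in> torus \<Longrightarrow> {v. g p v \<noteq> 0} \<in> K"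
  using g_in by (auto simp: geometric_realization_def)

lemma support_vertex: "p \<in> torus \<Longrightarrow> g p v \<noteq> 0 \<Longrightarrow> v \<in> \<Union>K"
  using support_in_K by blast

lemma face_in_K: "S \<in> K \<Longrightarrow> T \<subseteq> S \<Longrightarrow> T \<noteq> {} \<Longrightarrow> T \<in> K"
  using complex_K unfolding abstract_simplicial_complex_def by blast

lemma torus_fst_nonzero: "p \<in> torus \<Longrightarrow> fst p \<noteq> 0"
  by (auto simp: torus_def)

lemma rt_nonzero:
  assumes "v \<in> \<Union>K" "p \<in> torus" "g p v \<noteq> 0"
  shows "rt v p \<noteq> 0"
  using rt_square [OF assms] torus_fst_nonzero [OF assms(2)] by auto

lemma norm_rt:
  assumes "v \<in> \<Union>K" "p \<in> torus" "g p v \<noteq> 0"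
  shows "norm (rt v p) = 1"
proof -
  have "norm ((rt v p)\<^sup>2) = 1"
    using rt_square [OF assms] assms(2) by (auto simp: torus_def)
  then show ?thesis
    by (simp add: norm_power power2_eq_1_iff) (smt (verit) norm_ge_zero)
qed

lemma e_nonzero: "e v \<noteq> 0" "sgn (e v) = 1"
  using e_pos [of v] by auto

lemma vertex_unique: "v \<in> \<Union>K \<Longrightarrow> u \<in> \<Union>K \<Longrightarrow> e v = e u \<Longrightarrow> v = u"
  using inj_e by (auto dest: inj_onD)

text \<open>On the connected intersection of two stars, the ratio of the two branches is continuous
  with values 1 and -1, hence constant. A relation that holds at one point therefore holds at all of
  them.\<close>

lemma rt_consistent:
  assumes uv: "u \<in> \<Union>K" "v \<in> \<Union>K"
    and p: "p \<in> torus" "g p u \<noteq> 0" "g p v \<noteq> 0" and p': "p' \<in> torus" "g p' u \<noteq> 0" "g p' v \<noteq> 0"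
    and eq: "a * rt u p = b * rt v p"
  shows "a * rt u p' = b * rt v p'"
proof -
  let ?S = "{p \<in> torus. g p u \<noteq> 0 \<and> g p v \<noteq> 0}"
  have cont: "continuous_on ?S (\<lambda>p. rt u p / rt v p)"
    using uv by (intro continuous_on_divide)
      (auto intro: continuous_on_subset [OF cont_rt] simp: rt_nonzero simp del: Union_iff)
  have "rt u y / rt v y \<in> {1, -1}" if "y \<in> ?S" for y
  proof -
    have "(rt u y / rt v y)\<^sup>2 = 1"
      using that uv rt_square torus_fst_nonzero by (simp add: power_divide del: Union_iff)
    then show ?thesis by (simp add: power2_eq_1_iff)
  qed
  then have "(\<lambda>p. rt u p / rt v p) ` ?S \<subseteq> {1, -1}" by blast
  then have "finite ((\<lambda>p. rt u p / rt v p) ` ?S)"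
    using finite_subset by blast
  then have "(\<lambda>p. rt u p / rt v p) constant_on ?S"
    by (intro continuous_finite_range_constant cont connected_stars)
  then have "rt u p / rt v p = rt u p' / rt v p'"
    using p p' unfolding constant_on_def by (metis (mono_tags, lifting) mem_Collect_eq)
  then obtain c where c: "rt u p = c * rt v p" "rt u p' = c * rt v p'"
    using rt_nonzero [OF uv(2) p(1,3)] rt_nonzero [OF uv(2) p'(1,3)]
    by (metis nonzero_eq_divide_eq)
  then have "a * c = b"
    using eq rt_nonzero [OF uv(2) p(1,3)] by simp
  then show ?thesis using c by auto
qed

lemma U_vertex:
  assumes q: "q \<in> U m" and v: "v \<in> \<Union>K" "\<bar>m\<bar> = e v"
  shows "q \<in> torus \<and> g (sq q) v \<noteq> 0 \<and> fst q = of_int (sgn m) * rt v (sq q)"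
proof -
  obtain u where u: "u \<in> \<Union>K" "\<bar>m\<bar> = e u"
    "q \<in> torus \<and> g (sq q) u \<noteq> 0 \<and> fst q = of_int (sgn m) * rt u (sq q)"
    using q unfolding U_def by blast
  have "u = v"
    by (rule vertex_unique [OF u(1) v(1)]) (use u(2) v(2) in simp)
  then show ?thesis using u(3) by simp
qed

lemma U_E:
  assumes "q \<in> U m"
  obtains v where "v \<in> \<Union>K" "\<bar>m\<bar> = e v" "m \<noteq> 0" "q \<in> torus" "g (sq q) v \<noteq> 0"
    "fst q = of_int (sgn m) * rt v (sq q)"
proof -
  obtain v where v: "v \<in> \<Union>K" "\<bar>m\<bar> = e v" "q \<in> torus" "g (sq q) v \<noteq> 0"
      "fst q = of_int (sgn m) * rt v (sq q)"
    using assms unfolding U_def by blast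
  moreover have "m \<noteq> 0" using v(2) e_pos [of v] by auto
  ultimately show thesis using that by blast
qed

lemma U_I: "v \<in> \<Union>K \<Longrightarrow> \<bar>m\<bar> = e v \<Longrightarrow> q \<in> torus \<Longrightarrow> g (sq q) v \<noteq> 0
    \<Longrightarrow> fst q = of_int (sgn m) * rt v (sq q) \<Longrightarrow> q \<in> U m"
  unfolding U_def by blast

lemma U_cover:
  assumes "v \<in> \<Union>K" "q \<in> torus" "g (sq q) v \<noteq> 0"
  shows "q \<in> U (e v) \<or> q \<in> U (- e v)"
proof -
  have "(fst q)\<^sup>2 = (rt v (sq q))\<^sup>2"
    using rt_square [OF assms(1) sq_in_torus [OF assms(2)] assms(3)] by (simp add: sq_def)
  then have "fst q = rt v (sq q) \<or> fst q = - rt v (sq q)"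
    by (simp add: power2_eq_iff)
  then show ?thesis
    using assms e_pos [of v] by (auto intro!: U_I [of v] simp: e_nonzero simp del: Union_iff)
qed

lemma U_disjoint: "q \<in> U m \<Longrightarrow> q \<notin> U (- m)"
proof
  assume q: "q \<in> U m" "q \<in> U (- m)"
  then obtain v where v: "v \<in> \<Union>K" "\<bar>m\<bar> = e v" "m \<noteq> 0" "q \<in> torus" "g (sq q) v \<noteq> 0"
      "fst q = of_int (sgn m) * rt v (sq q)"
    by (elim U_E)
  moreover have "fst q = of_int (sgn (- m)) * rt v (sq q)"
    using U_vertex [OF q(2) v(1)] v(2) by simp
  ultimately have "fst q = - fst q"
    by (simp add: sgn_minus)
  then show False
    using torus_fst_nonzero [OF v(4)] by simp
qed

section \<open>The deck transformation and the lifted complex\<close>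

definition deck :: "complex \<times> complex \<Rightarrow> complex \<times> complex" where
  "deck q = (- fst q, snd q)"

lemma deck_in_torus: "q \<in> torus \<Longrightarrow> deck q \<in> torus"
  by (auto simp: torus_def deck_def mem_Times_iff)

lemma sq_deck: "sq (deck q) = sq q"
  by (simp add: sq_def deck_def)

lemma deck_U: "q \<in> U m \<Longrightarrow> deck q \<in> U (- m)"
  by (erule U_E, rule U_I) (auto simp: deck_in_torus sq_deck sgn_minus, simp add: deck_def)

lemma deck_U_iff: "deck q \<in> U m \<longleftrightarrow> q \<in> U (- m)"
  using deck_U [of q "- m"] deck_U [of "deck q" m] by (auto simp: deck_def)

lemma L_E:
  assumes "S \<in> L"
  obtains q where "q \<in> torus" "\<forall>m\<in>S. q \<in> U m" "S \<noteq> {}"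
  using assms unfolding L_def by blast

lemma L_I: "S \<noteq> {} \<Longrightarrow> q \<in> torus \<Longrightarrow> (\<And>m. m \<in> S \<Longrightarrow> q \<in> U m) \<Longrightarrow> S \<in> L"
  unfolding L_def by blast

lemma L_no_opposite:
  assumes "S \<in> L" "m \<in> S"
  shows "- m \<notin> S"
proof -
  obtain q where q: "q \<in> torus" "\<forall>m\<in>S. q \<in> U m" "S \<noteq> {}"
    using assms(1) by (rule L_E)
  then show ?thesis
    using U_disjoint [OF bspec [OF q(2) assms(2)]] by blast
qed

lemma L_vertex:
  assumes "S \<in> L" "m \<in> S"
  obtains v where "v \<in> \<Union>K" "\<bar>m\<bar> = e v"
proof -
  obtain q where "q \<in> U m"
    using assms by (meson L_E)
  then show thesis
    using that by (rule U_E)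
qed

lemma vertices_L: "m \<in> \<Union>L \<longleftrightarrow> (\<exists>q. q \<in> U m)"
proof
  show "m \<in> \<Union>L \<Longrightarrow> \<exists>q. q \<in> U m"
    unfolding L_def by blast
  assume "\<exists>q. q \<in> U m"
  then obtain q where "q \<in> U m" ..
  then have "{m} \<in> L"
    unfolding L_def by (auto elim: U_E)
  then show "m \<in> \<Union>L" by blast
qed

lemma abs_eq_vertex: "\<bar>m\<bar> = e v \<longleftrightarrow> m = e v \<or> m = - e v"
  using e_pos [of v] by auto

text \<open>If \<open>q\<close> is common to the lifted stars, every vertex of the shadow has a
  nonzero coordinate at \<open>sq q\<close>; so the shadow is a face of the simplex carrying
  \<open>sq q\<close>.\<close>

lemma shadow_in_K:
  assumes "S \<in> L"
  shows "shadow S \<in> K"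
proof -
  obtain q where q: "q \<in> torus" "\<forall>m\<in>S. q \<in> U m" and "S \<noteq> {}"
    using assms by (rule L_E)
  have "g (sq q) v \<noteq> 0" if "v \<in> shadow S" for v
  proof -
    have v: "v \<in> \<Union>K" and "e v \<in> S \<or> - e v \<in> S"
      using that by (simp_all add: shadow_def)
    from this(2) show ?thesis
    proof
      assume "e v \<in> S"
      from U_vertex [OF bspec [OF q(2) this] v] show ?thesis using e_pos [of v] by simp
    next
      assume "- e v \<in> S"
      from U_vertex [OF bspec [OF q(2) this] v] show ?thesis using e_pos [of v] by simp
    qed
  qed
  then have sub: "shadow S \<subseteq> {v. g (sq q) v \<noteq> 0}"
    by blast
  obtain m where m: "m \<in> S" using \<open>S \<noteq> {}\<close> by blast
  obtain v where v: "v \<in> \<Union>K" "\<bar>m\<bar> = e v"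
    using L_vertex [OF assms m] .
  then have "v \<in> shadow S"
    using m v by (auto simp: shadow_def abs_eq_vertex simp del: Union_iff)
  then have "shadow S \<noteq> {}" by auto
  then show ?thesis
    by (rule face_in_K [OF support_in_K [OF sq_in_torus [OF q(1)]] sub])
qed

text \<open>No simplex contains both lifts of a vertex, so \<open>abs\<close> is injective on it and
  identifies it with the indices of its shadow.\<close>

lemma card_shadow:
  assumes "S \<in> L"
  shows "card (shadow S) = card S"
proof -
  have "inj_on abs S"
    using L_no_opposite [OF assms] by (auto simp: inj_on_def abs_eq_iff)
  moreover have "abs ` S = e ` shadow S"
  proof
    show "abs ` S \<subseteq> e ` shadow S"
    proof
      fix n assume "n \<in> abs ` S"
      then obtain m where m: "m \<in> S" "n = \<bar>m\<bar>" by blast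
      obtain v where "v \<in> \<Union>K" "\<bar>m\<bar> = e v" using L_vertex [OF assms m(1)] .
      then have "v \<in> shadow S" "n = e v"
        using m by (auto simp: shadow_def abs_eq_vertex simp del: Union_iff)
      then show "n \<in> e ` shadow S" by blast
    qed
    show "e ` shadow S \<subseteq> abs ` S"
    proof
      fix n assume "n \<in> e ` shadow S"
      then obtain v where v: "n = e v" "e v \<in> S \<or> - e v \<in> S"
        by (auto simp: shadow_def)
      have "n = \<bar>e v\<bar>" "n = \<bar>- e v\<bar>" using v(1) e_pos [of v] by auto
      then show "n \<in> abs ` S" using v(2) by blast
    qed
  qed
  moreover have "inj_on e (shadow S)"
    by (rule inj_on_subset [OF inj_e]) (auto simp: shadow_def)
  ultimately show ?thesis
    by (metis card_image)
qed

lemma finite_L: "finite L"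
proof -
  have "L \<subseteq> Pow (e ` \<Union>K \<union> uminus ` e ` \<Union>K)"
  proof
    fix S assume S: "S \<in> L"
    have "m \<in> e ` \<Union>K \<union> uminus ` e ` \<Union>K" if m: "m \<in> S" for m
    proof -
      obtain v where "v \<in> \<Union>K" "\<bar>m\<bar> = e v" using L_vertex [OF S m] .
      then show ?thesis by (auto simp: abs_eq_vertex simp del: Union_iff)
    qed
    then show "S \<in> Pow (e ` \<Union>K \<union> uminus ` e ` \<Union>K)"
      by (intro PowI subsetI)
  qed
  then show ?thesis
    by (rule finite_subset) (use finite_vertices in simp)
qed

lemma finite_simplex_L: "S \<in> L \<Longrightarrow> finite S"
proof -
  assume S: "S \<in> L"
  have "0 < card (shadow S)"
    using shadow_in_K [OF S] complex_K by (simp add: abstract_simplicial_complex_def card_gt_0_iff)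
  then show "finite S"
    unfolding card_shadow [OF S] by (rule card_ge_0_finite)
qed

lemma complex_L: "abstract_simplicial_complex L"
proof -
  have "T \<in> L" if "S \<in> L" "T \<subseteq> S" "T \<noteq> {}" for S T
    using that by (elim L_E, intro L_I) auto
  then show ?thesis
    unfolding abstract_simplicial_complex_def using finite_simplex_L by (auto simp: L_def)
qed

lemma dim_L: "S \<in> L \<Longrightarrow> card S \<le> 3"
  using card_shadow [of S] dim_K [OF shadow_in_K [of S]] by simp

text \<open>Below a common point of the stars of \<open>S\<close>, both sides equal the first
  coordinate of that point; \<open>rt_consistent\<close> carries the equality to \<open>p\<close>.
  Thus the vertices of a simplex agree on the sheet.\<close>

lemma sign_consistent:
  assumes S: "S \<in> L" "m \<in> S" "n \<in> S" and u: "u \<in> \<Union>K" "\<bar>m\<bar> = e u" and v: "v \<in> \<Union>K" "\<bar>n\<bar> = e v"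
    and p: "p \<in> torus" "g p u \<noteq> 0" "g p v \<noteq> 0"
  shows "of_int (sgn m) * rt u p = of_int (sgn n) * rt v p"
proof -
  obtain q where q: "q \<in> torus" "\<forall>m\<in>S. q \<in> U m" "S \<noteq> {}"
    using S(1) by (rule L_E)
  note qu = U_vertex [OF bspec [OF q(2) S(2)] u] and qv = U_vertex [OF bspec [OF q(2) S(3)] v]
  show ?thesis
    by (rule rt_consistent [OF u(1) v(1) sq_in_torus [OF q(1)] _ _ p]) (use qu qv in auto)
qed

section \<open>The realization of the lifted complex and its map to the torus\<close>

definition push :: "(int \<Rightarrow> real) \<Rightarrow> 'v \<Rightarrow> real" where
  "push x = (\<lambda>v. if v \<in> \<Union>K then x (e v) + x (- e v) else 0)"

text \<open>The lift of \<open>h \<circ> push\<close> through \<open>sq\<close>. Each vertex in the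
  support of a point of the realization names a square root; by \<open>sign_consistent\<close> all
  name the same one, so \<open>SOME\<close> has a single candidate.\<close>

definition lift :: "(int \<Rightarrow> real) \<Rightarrow> complex \<times> complex" where
  "lift x = (SOME z. \<exists>m v. x m \<noteq> 0 \<and> v \<in> \<Union>K \<and> \<bar>m\<bar> = e v \<and> z = of_int (sgn m) * rt v (h (push x)),
    snd (h (push x)))"

lemma support_in_L: "x \<in> geometric_realization L \<Longrightarrow> {m. x m \<noteq> 0} \<in> L"
  and realization_nonneg: "x \<in> geometric_realization L \<Longrightarrow> 0 \<le> x m"
  by (auto simp: geometric_realization_def)

lemma push_support:
  assumes "x \<in> geometric_realization L"
  shows "{v. push x v \<noteq> 0} = shadow {m. x m \<noteq> 0}"
proof -
  have "x (e v) + x (- e v) = 0 \<longleftrightarrow> x (e v) = 0 \<and> x (- e v) = 0" for v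
    using realization_nonneg [OF assms] by (simp add: add_nonneg_eq_0_iff)
  then show ?thesis
    by (auto simp: push_def shadow_def)
qed

lemma push_in_realization:
  assumes x: "x \<in> geometric_realization L"
  shows "push x \<in> geometric_realization K"
proof -
  let ?S = "{m. x m \<noteq> 0}"
  let ?\<sigma> = "shadow ?S"
  have S: "?S \<in> L" using support_in_L [OF x] .
  have \<sigma>: "?\<sigma> \<in> K" using shadow_in_K [OF S] .
  have fin: "finite ?\<sigma>" using \<sigma> complex_K by (simp add: abstract_simplicial_complex_def)
  have inj: "inj_on e ?\<sigma>"
    by (rule inj_on_subset [OF inj_e]) (auto simp: shadow_def)
  have inj': "inj_on (\<lambda>v. - e v) ?\<sigma>"
    using inj by (auto simp: inj_on_def)
  have "sum (push x) ?\<sigma> = (\<Sum>v\<in>?\<sigma>. x (e v) + x (- e v))"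
    by (rule sum.cong [OF refl]) (simp add: push_def shadow_def)
  also have "\<dots> = sum x (e ` ?\<sigma>) + sum x ((\<lambda>v. - e v) ` ?\<sigma>)"
    using sum.reindex [OF inj, of x] sum.reindex [OF inj', of x] by (simp add: sum.distrib o_def)
  also have "\<dots> = sum x (e ` ?\<sigma> \<union> (\<lambda>v. - e v) ` ?\<sigma>)"
  proof (rule sum.union_disjoint [symmetric])
    have "e u \<noteq> - e v" for u v
      using e_pos [of u] e_pos [of v] by linarith
    then show "e ` ?\<sigma> \<inter> (\<lambda>v. - e v) ` ?\<sigma> = {}" by blast
  qed (use fin in auto)
  also have "\<dots> = 1"
  proof (rule geometric_realization_sum [OF x])
    show "finite (e ` ?\<sigma> \<union> (\<lambda>v. - e v) ` ?\<sigma>)" using fin by simp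
    show "?S \<subseteq> e ` ?\<sigma> \<union> (\<lambda>v. - e v) ` ?\<sigma>"
    proof
      fix m assume m: "m \<in> ?S"
      obtain v where v: "v \<in> \<Union>K" "\<bar>m\<bar> = e v" using L_vertex [OF S m] .
      then have m_eq: "m = e v \<or> m = - e v" by (simp add: abs_eq_vertex)
      then have "v \<in> ?\<sigma>" using v(1) m unfolding shadow_def by auto
      then show "m \<in> e ` ?\<sigma> \<union> (\<lambda>v. - e v) ` ?\<sigma>" using m_eq by blast
    qed
  qed
  finally have sum: "sum (push x) ?\<sigma> = 1" .
  show ?thesis
  proof (rule geometric_realizationI [OF complex_K \<sigma>])
    show "0 \<le> push x v" for v
      using realization_nonneg [OF x] by (simp add: push_def)
    show "{v. push x v \<noteq> 0} \<subseteq> ?\<sigma>"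
      using push_support [OF x] by simp
  qed (rule sum)
qed

lemma push_nonzero:
  assumes "x \<in> geometric_realization L" "x m \<noteq> 0" "v \<in> \<Union>K" "\<bar>m\<bar> = e v"
  shows "push x v \<noteq> 0"
proof -
  have "v \<in> shadow {m. x m \<noteq> 0}"
    using assms(2-4) unfolding shadow_def abs_eq_vertex by auto
  then show ?thesis
    using push_support [OF assms(1)] by blast
qed

lemma lift_eq:
  assumes x: "x \<in> geometric_realization L" and m: "x m \<noteq> 0" "v \<in> \<Union>K" "\<bar>m\<bar> = e v"
  shows "lift x = (of_int (sgn m) * rt v (h (push x)), snd (h (push x)))"
proof -
  let ?p = "h (push x)"
  have p: "?p \<in> torus" "g ?p = push x"
    using push_in_realization [OF x] by (simp_all add: h_in g_h)
  have "(SOME z. \<exists>m v. x m \<noteq> 0 \<and> v \<in> \<Union>K \<and> \<bar>m\<bar> = e v \<and> z = of_int (sgn m) * rt v ?p)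
      = of_int (sgn m) * rt v ?p"
  proof (rule some_equality)
    show "\<exists>n u. x n \<noteq> 0 \<and> u \<in> \<Union>K \<and> \<bar>n\<bar> = e u \<and> of_int (sgn m) * rt v ?p = of_int (sgn n) * rt u ?p"
      using m by blast
    fix z assume "\<exists>n u. x n \<noteq> 0 \<and> u \<in> \<Union>K \<and> \<bar>n\<bar> = e u \<and> z = of_int (sgn n) * rt u ?p"
    then obtain n u where n: "x n \<noteq> 0" "u \<in> \<Union>K" "\<bar>n\<bar> = e u" and z: "z = of_int (sgn n) * rt u ?p"
      by blast
    show "z = of_int (sgn m) * rt v ?p"
      unfolding z
      by (rule sign_consistent [OF support_in_L [OF x] _ _ n(2,3) m(2,3) p(1)])
        (use n m p push_nonzero [OF x] in auto)
  qed
  then show ?thesis by (simp add: lift_def)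
qed

lemma realization_vertex:
  assumes "x \<in> geometric_realization L"
  obtains m v where "x m \<noteq> 0" "v \<in> \<Union>K" "\<bar>m\<bar> = e v"
proof -
  have "{m. x m \<noteq> 0} \<noteq> {}"
    using support_in_L [OF assms] by (simp add: L_def)
  then obtain m where m: "m \<in> {m. x m \<noteq> 0}" by blast
  obtain v where "v \<in> \<Union>K" "\<bar>m\<bar> = e v"
    using L_vertex [OF support_in_L [OF assms] m] .
  then show thesis using that m by simp
qed

lemma lift_in_torus:
  assumes x: "x \<in> geometric_realization L"
  shows "lift x \<in> torus" "sq (lift x) = h (push x)"
proof -
  obtain m v where m: "x m \<noteq> 0" "v \<in> \<Union>K" "\<bar>m\<bar> = e v"
    using realization_vertex [OF x] .
  let ?p = "h (push x)"
  have p: "?p \<in> torus" "g ?p v \<noteq> 0"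
    using push_in_realization [OF x] push_nonzero [OF x m] by (simp_all add: h_in g_h)
  have "m \<noteq> 0" using m(3) e_pos [of v] by auto
  then have s: "norm (of_int (sgn m) :: complex) = 1" "(of_int (sgn m) :: complex)\<^sup>2 = 1"
    by (auto simp: sgn_if)
  show "lift x \<in> torus"
    using p(1) norm_rt [OF m(2) p] s by (simp add: lift_eq [OF x m] torus_def norm_mult mem_Times_iff)
  show "sq (lift x) = ?p"
    using rt_square [OF m(2) p] s by (simp add: lift_eq [OF x m] sq_def power_mult_distrib)
qed

text \<open>If \<open>x m\<close> were 0, the vertex below \<open>m\<close> could receive its weight
  only from \<open>- m\<close>, and then \<open>lift x\<close> would lie on the opposite
  sheet.\<close>

lemma lift_carrier:
  assumes x: "x \<in> geometric_realization L" and U: "lift x \<in> U m"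
  shows "x m \<noteq> 0"
proof
  assume "x m = 0"
  obtain v where v: "v \<in> \<Union>K" "\<bar>m\<bar> = e v" "lift x \<in> torus" "g (sq (lift x)) v \<noteq> 0"
      "fst (lift x) = of_int (sgn m) * rt v (sq (lift x))"
    using U by (elim U_E)
  have "push x v \<noteq> 0"
    using v(4) lift_in_torus(2) [OF x] push_in_realization [OF x] by (simp add: g_h)
  then have "x (e v) \<noteq> 0 \<or> x (- e v) \<noteq> 0"
    by (auto simp: push_def split: if_splits)
  then have "x (- m) \<noteq> 0"
    using v(2) \<open>x m = 0\<close> unfolding abs_eq_vertex by auto
  then have "fst (lift x) = of_int (sgn (- m)) * rt v (h (push x))"
    using lift_eq [OF x _ v(1), of "- m"] v(2) by simp
  then have "fst (lift x) = - fst (lift x)"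
    using v(5) lift_in_torus(2) [OF x] by (simp add: sgn_minus)
  then show False
    using torus_fst_nonzero [OF v(3)] by simp
qed

lemma continuous_on_push: "continuous_on A push"
  unfolding push_def
proof (rule continuous_on_coordinatewise_then_product)
  fix v
  have "continuous_on A (\<lambda>x. x i :: real)" for i :: int
    by (rule continuous_on_product_then_coordinatewise) (rule continuous_on_id)
  then show "continuous_on A (\<lambda>x. if v \<in> \<Union>K then x (e v) + x (- e v) else 0)"
    by (cases "v \<in> \<Union>K") (simp_all add: continuous_on_add del: Union_iff)
qed

text \<open>Continuity is local: on each relatively open set \<open>W m\<close> the explicit formula
  of \<open>lift_eq\<close> applies, and these sets cover because every point has a vertex in its
  support.\<close>

lemma continuous_on_lift: "continuous_on (geometric_realization L) lift"
  unfolding continuous_openin_preimage_eq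
proof (intro allI impI)
  let ?R = "geometric_realization L"
  fix T :: "(complex \<times> complex) set" assume "open T"
  define W where "W = (\<lambda>m. {x \<in> ?R. x m \<noteq> 0})"
  have openW: "openin (top_of_set ?R) (W m)" for m
  proof -
    have "W m = ?R \<inter> (\<lambda>x. x m) -` (- {0})" by (auto simp: W_def)
    moreover have "continuous_on ?R (\<lambda>x. x m)"
      by (rule continuous_on_product_then_coordinatewise) (rule continuous_on_id)
    ultimately show ?thesis
      using continuous_openin_preimage_gen [of ?R "\<lambda>x. x m" "- {0}"] by (simp add: open_Compl)
  qed
  have contW: "continuous_on (W m) lift" if "\<bar>m\<bar> = e v" "v \<in> \<Union>K" for m v
  proof -
    have push: "push ` W m \<subseteq> geometric_realization K"
      using push_in_realization by (auto simp: W_def)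
    have hp: "continuous_on (W m) (\<lambda>x. h (push x))"
      using continuous_on_compose2 [OF cont_h continuous_on_push push] .
    have "(\<lambda>x. h (push x)) ` W m \<subseteq> {p \<in> torus. g p v \<noteq> 0}"
      using push_in_realization push_nonzero [OF _ _ that(2,1)] by (auto simp: W_def h_in g_h)
    then have "continuous_on (W m) (\<lambda>x. rt v (h (push x)))"
      using continuous_on_compose2 [OF cont_rt [OF that(2)] hp] by blast
    then have "continuous_on (W m) (\<lambda>x. (of_int (sgn m) * rt v (h (push x)), snd (h (push x))))"
      by (intro continuous_intros hp)
    then show ?thesis
      by (rule continuous_on_eq) (use lift_eq [OF _ _ that(2,1)] in \<open>simp add: W_def\<close>)
  qed
  have eq: "?R \<inter> lift -` T = (\<Union>m\<in>{m. \<exists>v\<in>\<Union>K. \<bar>m\<bar> = e v}. W m \<inter> lift -` T)"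
  proof
    show "?R \<inter> lift -` T \<subseteq> (\<Union>m\<in>{m. \<exists>v\<in>\<Union>K. \<bar>m\<bar> = e v}. W m \<inter> lift -` T)"
    proof
      fix x assume x: "x \<in> ?R \<inter> lift -` T"
      then have "x \<in> ?R" by simp
      then obtain m v where m: "x m \<noteq> 0" "v \<in> \<Union>K" "\<bar>m\<bar> = e v"
        by (rule realization_vertex)
      then have "x \<in> W m \<inter> lift -` T" "m \<in> {m. \<exists>v\<in>\<Union>K. \<bar>m\<bar> = e v}"
        using x by (auto simp: W_def simp del: Union_iff)
      then show "x \<in> (\<Union>m\<in>{m. \<exists>v\<in>\<Union>K. \<bar>m\<bar> = e v}. W m \<inter> lift -` T)"
        by (rule UN_I [rotated])
    qed
  qed (auto simp: W_def)
  have open_piece: "openin (top_of_set ?R) (W m \<inter> lift -` T)" if "m \<in> {m. \<exists>v\<in>\<Union>K. \<bar>m\<bar> = e v}" for m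
  proof -
    have "\<exists>v\<in>\<Union>K. \<bar>m\<bar> = e v" using that by (rule CollectD)
    then obtain v where "v \<in> \<Union>K" "\<bar>m\<bar> = e v" by (rule bexE)
    then have "openin (top_of_set (W m)) (W m \<inter> lift -` T)"
      by (intro continuous_openin_preimage_gen [OF _ \<open>open T\<close>] contW)
    then show ?thesis
      by (rule openin_trans) (rule openW)
  qed
  show "openin (top_of_set ?R) (?R \<inter> lift -` T)"
    unfolding eq by (rule openin_Union, elim imageE) (simp only: open_piece)
qed

text \<open>Over the star the first coordinate is plus or minus the selected root, so its distance
  from that root is 0 or 2. The bound 1 lies strictly between and cuts out one sheet as an open
  set.\<close>

lemma open_U:
  assumes "m \<in> \<Union>L"
  shows "openin (top_of_set torus) (U m)"
proof -
  obtain v where v: "v \<in> \<Union>K" "\<bar>m\<bar> = e v"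
    using assms by (meson UnionE L_vertex)
  define A where "A = torus \<inter> (\<lambda>q. g (sq q) v) -` (- {0})"
  have gsq: "continuous_on torus (\<lambda>q. g (sq q))"
    by (rule continuous_on_compose2 [OF cont_g continuous_on_sq]) (auto simp: sq_in_torus)
  have A: "openin (top_of_set torus) A"
    unfolding A_def
    by (rule continuous_openin_preimage_gen [OF continuous_on_product_then_coordinatewise [OF gsq]]) auto
  have "continuous_on A (\<lambda>q. rt v (sq q))"
    by (rule continuous_on_compose2 [OF cont_rt [OF v(1)] continuous_on_sq]) (auto simp: A_def sq_in_torus)
  then have "continuous_on A (\<lambda>q. norm (fst q - of_int (sgn m) * rt v (sq q)))"
    by (intro continuous_intros)
  then have "openin (top_of_set A) (A \<inter> (\<lambda>q. norm (fst q - of_int (sgn m) * rt v (sq q))) -` {..<1})"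
    by (rule continuous_openin_preimage_gen) auto
  moreover have "A \<inter> (\<lambda>q. norm (fst q - of_int (sgn m) * rt v (sq q))) -` {..<1} = U m"
  proof (intro equalityI subsetI)
    fix q assume q: "q \<in> A \<inter> (\<lambda>q. norm (fst q - of_int (sgn m) * rt v (sq q))) -` {..<1}"
    then have qA: "q \<in> torus" "g (sq q) v \<noteq> 0" by (auto simp: A_def)
    have "m \<noteq> 0" using v(2) e_pos [of v] by auto
    then have "(of_int (sgn m) :: complex)\<^sup>2 = 1" by (auto simp: sgn_if)
    then have "(fst q)\<^sup>2 = (of_int (sgn m) * rt v (sq q))\<^sup>2"
      using rt_square [OF v(1) sq_in_torus [OF qA(1)] qA(2)] by (simp add: sq_def power_mult_distrib)
    then have "fst q = of_int (sgn m) * rt v (sq q) \<or> fst q = - (of_int (sgn m) * rt v (sq q))"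
      by (simp only: power2_eq_iff)
    then show "q \<in> U m"
    proof
      assume "fst q = of_int (sgn m) * rt v (sq q)"
      then show ?thesis by (rule U_I [OF v qA])
    next
      assume "fst q = - (of_int (sgn m) * rt v (sq q))"
      then have "of_int (sgn m) * rt v (sq q) = - fst q" by simp
      then have "norm (fst q - of_int (sgn m) * rt v (sq q)) = norm (2 * fst q)" by simp
      also have "\<dots> = 2" using qA(1) by (auto simp: torus_def norm_mult)
      finally show ?thesis using q by simp
    qed
  next
    fix q assume "q \<in> U m"
    from U_vertex [OF this v] show "q \<in> A \<inter> (\<lambda>q. norm (fst q - of_int (sgn m) * rt v (sq q))) -` {..<1}"
      by (simp add: A_def)
  qed
  ultimately show ?thesis
    using A openin_trans by metis
qed

sublocale cover: star_cover L torus U lift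
proof
  show "finite L" by (rule finite_L)
  show "abstract_simplicial_complex L" by (rule complex_L)
  show "card S \<le> 3" if "S \<in> L" for S using dim_L [OF that] .
  show "compact torus" unfolding torus_def by (intro compact_Times) auto
  show "openin (top_of_set torus) (U m)" if "m \<in> \<Union>L" for m using open_U [OF that] .
  show "torus \<subseteq> (\<Union>m\<in>\<Union>L. U m)"
  proof
    fix q assume q: "q \<in> torus"
    have "{v. g (sq q) v \<noteq> 0} \<in> K"
      using support_in_K [OF sq_in_torus [OF q]] .
    then have "{v. g (sq q) v \<noteq> 0} \<noteq> {}"
      using complex_K unfolding abstract_simplicial_complex_def by blast
    then obtain v where "g (sq q) v \<noteq> 0" by blast
    then obtain m where "q \<in> U m"
      using U_cover [OF support_vertex [OF sq_in_torus [OF q]] q] by blast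
    moreover from this have "m \<in> \<Union>L" unfolding vertices_L by (rule exI)
    ultimately show "q \<in> (\<Union>m\<in>\<Union>L. U m)" by (rule UN_I [rotated])
  qed
  show "S \<in> L" if "S \<subseteq> \<Union>L" "S \<noteq> {}" "q \<in> torus" "\<And>m. m \<in> S \<Longrightarrow> q \<in> U m" for S q
    using that(2-4) by (rule L_I)
  show "continuous_on (geometric_realization L) lift" by (rule continuous_on_lift)
  show "lift ` geometric_realization L \<subseteq> torus" using lift_in_torus(1) by blast
  show "x m \<noteq> 0" if "x \<in> geometric_realization L" "m \<in> \<Union>L" "lift x \<in> U m" for x m
    using lift_carrier [OF that(1,3)] .
qed

text \<open>The homotopy turns the first coordinate through the angle \<open>pi * t\<close>. If
  \<open>deck (lift x)\<close> lay in \<open>U m\<close>, then \<open>lift x\<close> would lie in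
  \<open>U (- m)\<close>, so \<open>- m\<close> would be in the support of \<open>x\<close> and
  hence in \<open>S\<close> together with \<open>m\<close>.\<close>

lemma euler_characteristic_L:
  "int (card (n_simplices 0 L)) - int (card (n_simplices 1 L)) + int (card (n_simplices 2 L)) = 0"
proof (rule cover.euler_characteristic_eq_0)
  let ?H = "\<lambda>(t :: real, q :: complex \<times> complex). (cis (pi * t) * fst q, snd q)"
  show "continuous_on ({0..1} \<times> torus) ?H"
    unfolding case_prod_unfold by (intro continuous_intros)
  show "?H ` ({0..1} \<times> torus) \<subseteq> torus"
    by (auto simp: torus_def norm_mult)
  show "?H (0, q) = q" for q by simp
  fix S x m
  assume S: "S \<in> L" and x: "x \<in> geometric_realization L" "{v. x v \<noteq> 0} \<subseteq> S" and m: "m \<in> S"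
  have "?H (1, lift x) = deck (lift x)"
    by (simp add: deck_def cis_pi)
  moreover have "deck (lift x) \<notin> U m"
    using lift_carrier [OF x(1), of "- m"] x(2) L_no_opposite [OF S m] unfolding deck_U_iff by blast
  ultimately show "?H (1, lift x) \<notin> U m" by metis
qed

section \<open>Counting the lifts of a simplex\<close>

lemma shadow_uminus: "shadow (uminus ` S) = shadow S"
proof -
  have "m \<in> uminus ` S \<longleftrightarrow> - m \<in> S" for m :: int
    by (metis imageE image_eqI minus_minus)
  then show ?thesis by (auto simp: shadow_def)
qed

lemma uminus_in_L:
  assumes "S \<in> L"
  shows "uminus ` S \<in> L"
proof -
  obtain q where q: "q \<in> torus" "\<forall>m\<in>S. q \<in> U m" "S \<noteq> {}"
    using assms by (rule L_E)
  show ?thesis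
    by (rule L_I [of _ "deck q"]) (use q in \<open>auto simp: deck_in_torus deck_U_iff\<close>)
qed

text \<open>Uniqueness of lifts: the sheet at \<open>m\<close> determines the sheet at every other
  vertex, since two branches differ by a constant sign.\<close>

lemma shadow_inj_subset:
  assumes S: "S \<in> L" "T \<in> L" "shadow S = shadow T" and m: "m \<in> S" "m \<in> T"
  shows "S \<subseteq> T"
proof
  fix n assume n: "n \<in> S"
  obtain u where u: "u \<in> \<Union>K" "\<bar>m\<bar> = e u" using L_vertex [OF S(1) m(1)] .
  obtain v where v: "v \<in> \<Union>K" "\<bar>n\<bar> = e v" using L_vertex [OF S(1) n] .
  have "v \<in> shadow S"
    using v n unfolding shadow_def abs_eq_vertex by auto
  then have "v \<in> shadow T"
    using S(3) by simp
  then have "n \<in> T \<or> - n \<in> T"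
    using v unfolding shadow_def abs_eq_vertex by auto
  moreover have False if n': "- n \<in> T"
  proof -
    obtain q where q: "q \<in> torus" "\<forall>m\<in>T. q \<in> U m" "T \<noteq> {}"
      using S(2) by (rule L_E)
    note qu = U_vertex [OF bspec [OF q(2) m(2)] u]
    have qv: "g (sq q) v \<noteq> 0 \<and> fst q = of_int (sgn (- n)) * rt v (sq q)"
      using U_vertex [OF bspec [OF q(2) n'] v(1)] v(2) by simp
    have "of_int (sgn m) * rt u (sq q) = of_int (sgn n) * rt v (sq q)"
      by (rule sign_consistent [OF S(1) m(1) n u v sq_in_torus [OF q(1)]]) (use qu qv in auto)
    then have "fst q = - fst q"
      using qu qv by (simp add: sgn_minus)
    then show False
      using torus_fst_nonzero [OF q(1)] by simp
  qed
  ultimately show "n \<in> T" by blast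
qed

text \<open>The barycentre \<open>b\<close> of \<sigma> lies in the stars of the vertices of
  \<sigma> and in no others. Any point above \<open>h b\<close> will do, here the one given by
  \<open>csqrt\<close>; the lifted stars through it form the required simplex.\<close>

lemma shadow_surj:
  assumes \<sigma>: "\<sigma> \<in> K"
  obtains S where "S \<in> L" "shadow S = \<sigma>"
proof -
  have fin: "finite \<sigma>" "\<sigma> \<noteq> {}"
    using \<sigma> complex_K by (auto simp: abstract_simplicial_complex_def)
  define b where "b = (\<lambda>v. if v \<in> \<sigma> then 1 / real (card \<sigma>) else 0)"
  have b: "b \<in> geometric_realization K"
    by (rule geometric_realizationI [OF complex_K \<sigma>]) (use fin in \<open>auto simp: b_def\<close>)
  define q where "q = (csqrt (fst (h b)), snd (h b))"
  have hb: "h b \<in> torus" using h_in [OF b] .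
  have sq: "sq q = h b" by (simp add: sq_def q_def)
  have q: "q \<in> torus"
    using hb by (auto simp: q_def torus_def mem_Times_iff norm_csqrt)
  have gq: "g (sq q) v \<noteq> 0 \<longleftrightarrow> v \<in> \<sigma>" for v
    unfolding sq g_h [OF b] using fin by (simp add: b_def)
  have shadow: "shadow {m. q \<in> U m} = \<sigma>"
  proof
    show "shadow {m. q \<in> U m} \<subseteq> \<sigma>"
    proof
      fix v assume "v \<in> shadow {m. q \<in> U m}"
      then have v: "v \<in> \<Union>K" "q \<in> U (e v) \<or> q \<in> U (- e v)"
        by (simp_all add: shadow_def)
      then have "g (sq q) v \<noteq> 0"
        using U_vertex [of q "e v" v] U_vertex [of q "- e v" v] e_pos [of v] by auto
      then show "v \<in> \<sigma>" by (simp add: gq)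
    qed
    show "\<sigma> \<subseteq> shadow {m. q \<in> U m}"
    proof
      fix v assume v: "v \<in> \<sigma>"
      then have "v \<in> \<Union>K" using \<sigma> by blast
      with v show "v \<in> shadow {m. q \<in> U m}"
        using U_cover [of v q] q gq by (simp add: shadow_def)
    qed
  qed
  have "{m. q \<in> U m} \<in> L"
  proof (rule L_I [OF _ q])
    show "{m. q \<in> U m} \<noteq> {}"
      using fin(2) unfolding shadow [symmetric] shadow_def by blast
  qed simp
  then show thesis using that shadow by blast
qed

text \<open>Every lift shares a vertex with \<open>S\<close> or with its negative, and
  \<open>shadow_inj_subset\<close> in both directions makes it equal to that one. The two are
  different because no simplex contains opposite vertices.\<close>

lemma card_shadow_fibre:
  assumes \<sigma>: "\<sigma> \<in> K"
  shows "card {S \<in> L. shadow S = \<sigma>} = 2"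
proof -
  obtain S where S: "S \<in> L" "shadow S = \<sigma>" using shadow_surj [OF \<sigma>] .
  have ne: "S \<noteq> {}" using S(1) by (simp add: L_def)
  have S': "uminus ` S \<in> L" "shadow (uminus ` S) = \<sigma>"
    using uminus_in_L [OF S(1)] shadow_uminus S(2) by auto
  have "T = S \<or> T = uminus ` S" if T: "T \<in> L" "shadow T = \<sigma>" for T
  proof -
    obtain m where m: "m \<in> T" using T(1) by (auto simp: L_def)
    obtain v where v: "v \<in> \<Union>K" "\<bar>m\<bar> = e v" using L_vertex [OF T(1) m] .
    have "v \<in> shadow T"
      using v m unfolding shadow_def abs_eq_vertex by auto
    then have "v \<in> shadow S" using S T by simp
    then have "m \<in> S \<or> - m \<in> S"
      using v unfolding shadow_def abs_eq_vertex by auto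
    then show ?thesis
    proof
      assume "m \<in> S"
      then show ?thesis
        using shadow_inj_subset [OF T(1) S(1) _ m] shadow_inj_subset [OF S(1) T(1) _ _ m] S T by auto
    next
      assume "- m \<in> S"
      then have "m \<in> uminus ` S" by force
      then show ?thesis
        using shadow_inj_subset [OF T(1) S'(1) _ m] shadow_inj_subset [OF S'(1) T(1) _ _ m] S' T by auto
    qed
  qed
  then have "{S \<in> L. shadow S = \<sigma>} = {S, uminus ` S}"
    using S S' by auto
  moreover have "S \<noteq> uminus ` S"
    using L_no_opposite [OF S(1)] ne by (metis equals0I image_eqI)
  ultimately show ?thesis by simp
qed

lemma card_n_simplices_L: "card (n_simplices k L) = 2 * card (n_simplices k K)"
proof -
  have fin: "finite (n_simplices k L)" "finite (n_simplices k K)"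
    using finite_L finite_K by (auto simp: n_simplices_def)
  have "shadow ` n_simplices k L \<subseteq> n_simplices k K"
    using shadow_in_K card_shadow by (auto simp: n_simplices_def)
  then have "card (n_simplices k L) = (\<Sum>\<sigma>\<in>n_simplices k K. card {S \<in> n_simplices k L. shadow S = \<sigma>})"
    using sum.group [OF fin, of shadow "\<lambda>_. 1 :: nat"] by simp
  also have "\<dots> = (\<Sum>\<sigma>\<in>n_simplices k K. 2)"
  proof (rule sum.cong [OF refl])
    fix \<sigma> assume \<sigma>: "\<sigma> \<in> n_simplices k K"
    then have "{S \<in> n_simplices k L. shadow S = \<sigma>} = {S \<in> L. shadow S = \<sigma>}"
      using card_shadow by (auto simp: n_simplices_def)
    then show "card {S \<in> n_simplices k L. shadow S = \<sigma>} = 2"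
      using card_shadow_fibre \<sigma> by (simp add: n_simplices_def)
  qed
  finally show ?thesis by simp
qed

lemma euler_characteristic_K:
  "int (card (n_simplices 0 K)) - int (card (n_simplices 1 K)) + int (card (n_simplices 2 K)) = 0"
  using euler_characteristic_L by (simp add: card_n_simplices_L)

end

section \<open>Open stars are contractible\<close>

text \<open>The segment in barycentric coordinates from a point to the barycentre \<open>b\<close>
  of \<sigma> stays in the simplex carrying the point, because that simplex contains \<sigma>, and
  keeps the coordinates in \<sigma> positive. One vertex yields the square root branches, a pair
  yields connected intersections of stars.\<close>

lemma contractible_open_star:
  fixes g :: "'a::topological_space \<Rightarrow> 'v \<Rightarrow> real"
  assumes K: "abstract_simplicial_complex K" and homeo: "homeomorphism (geometric_realization K) M h g"
    and \<sigma>: "\<sigma> \<in> K"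
  shows "contractible {p \<in> M. \<forall>v\<in>\<sigma>. g p v \<noteq> 0}" (is "contractible ?S")
proof -
  have fin: "finite \<sigma>" "\<sigma> \<noteq> {}"
    using \<sigma> K by (auto simp: abstract_simplicial_complex_def)
  define b where "b = (\<lambda>v. if v \<in> \<sigma> then 1 / real (card \<sigma>) else 0)"
  define c where "c = (\<lambda>y :: real \<times> 'a. \<lambda>v. (1 - fst y) * g (snd y) v + fst y * b v)"
  have sum_b: "sum b A = 1" if "finite A" "\<sigma> \<subseteq> A" for A
  proof -
    have "sum b A = sum b \<sigma>"
      by (rule sum.mono_neutral_right) (use that in \<open>auto simp: b_def\<close>)
    then show ?thesis using fin by (simp add: b_def)
  qed
  have c_real: "c (t, p) \<in> geometric_realization K" and c_pos: "v \<in> \<sigma> \<Longrightarrow> c (t, p) v \<noteq> 0"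
    if t: "t \<in> {0..1}" and p: "p \<in> ?S" for t p v
  proof -
    have gp: "g p \<in> geometric_realization K"
      using p homeo by (auto simp: homeomorphism_def)
    then have supp: "{v. g p v \<noteq> 0} \<in> K" and nonneg: "\<And>v. 0 \<le> g p v"
      by (auto simp: geometric_realization_def)
    have fin': "finite {v. g p v \<noteq> 0}"
      using supp K by (auto simp: abstract_simplicial_complex_def)
    have sub: "\<sigma> \<subseteq> {v. g p v \<noteq> 0}" using p by auto
    show "c (t, p) \<in> geometric_realization K"
    proof (rule geometric_realizationI [OF K supp])
      show "0 \<le> c (t, p) v" for v
        using t nonneg by (simp add: c_def b_def)
      show "{v. c (t, p) v \<noteq> 0} \<subseteq> {v. g p v \<noteq> 0}"
        using sub by (auto simp: c_def b_def split: if_splits)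
      show "sum (c (t, p)) {v. g p v \<noteq> 0} = 1"
        using geometric_realization_sum [OF gp fin' order_refl] sum_b [OF fin' sub]
        by (simp add: c_def sum.distrib flip: sum_distrib_left)
    qed
    assume v: "v \<in> \<sigma>"
    then have pos: "0 < g p v" "0 < b v"
      using sub nonneg [of v] fin by (auto simp: b_def card_gt_0_iff less_le)
    have "0 < c (t, p) v"
    proof (cases "t = 1")
      case False
      then show ?thesis
        using t pos by (auto simp: c_def intro!: add_pos_nonneg)
    qed (use pos in \<open>simp add: c_def\<close>)
    then show "c (t, p) v \<noteq> 0" by simp
  qed
  have cont_g: "continuous_on ?S g"
    using homeo by (auto simp: homeomorphism_def intro: continuous_on_subset)
  have cont_c: "continuous_on ({0..1::real} \<times> ?S) c"
    unfolding c_def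
  proof (rule continuous_on_coordinatewise_then_product)
    fix v
    have "continuous_on ({0..1::real} \<times> ?S) (\<lambda>y. g (snd y) v)"
      by (rule continuous_on_product_then_coordinatewise, rule continuous_on_compose2 [OF cont_g])
        (auto intro!: continuous_intros)
    then show "continuous_on ({0..1::real} \<times> ?S) (\<lambda>y. (1 - fst y) * g (snd y) v + fst y * b v)"
      by (intro continuous_intros)
  qed
  have "continuous_on ({0..1::real} \<times> ?S) (\<lambda>y. h (c y))"
    by (rule continuous_on_compose2 [OF _ cont_c])
      (use homeo c_real in \<open>auto simp: homeomorphism_def\<close>)
  moreover have "(\<lambda>y. h (c y)) \<in> {0..1::real} \<times> ?S \<rightarrow> ?S"
  proof
    fix y assume "y \<in> {0..1::real} \<times> ?S"
    then obtain t p where y: "y = (t, p)" "t \<in> {0..1}" "p \<in> ?S" by (cases y) blast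
    show "h (c y) \<in> ?S"
      unfolding y(1) using c_real [OF y(2,3)] c_pos [OF y(2,3)] homeo by (auto simp: homeomorphism_def)
  qed
  moreover have "h (c (0, p)) = p" if "p \<in> ?S" for p
    using that homeo by (auto simp: c_def homeomorphism_def)
  moreover have "h (c (1, p)) = h b" for p
    by (simp add: c_def)
  ultimately have "homotopic_with_canon (\<lambda>_. True) ?S ?S id (\<lambda>_. h b)"
    by (subst homotopic_with) (auto intro!: exI [of _ "\<lambda>y. h (c y)"])
  then show ?thesis
    unfolding contractible_def by blast
qed

theorem mainTheorem3:
  fixes K :: "'v set set" and h :: "('v \<Rightarrow> real) \<Rightarrow> complex \<times> complex"
  assumes "surface_triangulation K h torus"
  shows "int (card (n_simplices 0 K)) - int (card (n_simplices 1 K))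
           + int (card (n_simplices 2 K)) = 0"
proof -
  obtain g where fin: "finite K" and K: "abstract_simplicial_complex K"
    and dim: "\<And>S. S \<in> K \<Longrightarrow> card S \<le> 3"
    and homeo: "homeomorphism (geometric_realization K) torus h g"
    using assms by (auto simp: surface_triangulation_def has_dimension_def numeral_3_eq_3)
  have "finite (\<Union>K)"
    using fin K by (auto simp: abstract_simplicial_complex_def)
  then obtain k :: "'v \<Rightarrow> nat" where "inj_on k (\<Union>K)"
    using finite_imp_inj_to_nat_seg by metis
  \<comment> \<open>Adding 1 makes the indices positive, so that an index and its negative are
    different.\<close>
  then have inj: "inj_on (\<lambda>v. int (k v) + 1) (\<Union>K)"
    by (auto simp: inj_on_def)
  have supp: "{v. g p v \<noteq> 0} \<in> K" if "p \<in> torus" for p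
    using that homeo by (auto simp: homeomorphism_def geometric_realization_def)
  have "\<forall>v\<in>\<Union>K. \<exists>r. continuous_on {p \<in> torus. g p v \<noteq> 0} r \<and>
      (\<forall>p\<in>torus. g p v \<noteq> 0 \<longrightarrow> (r p)\<^sup>2 = fst p)"
  proof
    fix v assume v: "v \<in> \<Union>K"
    have "{v} \<in> K"
      using v K unfolding abstract_simplicial_complex_def by blast
    then have contr: "contractible {p \<in> torus. g p v \<noteq> 0}"
      using contractible_open_star [OF K homeo, of "{v}"] by simp
    have cont: "continuous_on {p \<in> torus. g p v \<noteq> 0} fst"
      by (intro continuous_intros)
    have nonzero: "fst p \<noteq> 0" if "p \<in> {p \<in> torus. g p v \<noteq> 0}" for p
      using that by (auto simp: torus_def)
    obtain r where "continuous_on {p \<in> torus. g p v \<noteq> 0} r"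
      "\<And>p. p \<in> {p \<in> torus. g p v \<noteq> 0} \<Longrightarrow> fst p = (r p)\<^sup>2"
      using continuous_sqrt_on_contractible [OF cont contr nonzero] by blast
    then show "\<exists>r. continuous_on {p \<in> torus. g p v \<noteq> 0} r \<and>
        (\<forall>p\<in>torus. g p v \<noteq> 0 \<longrightarrow> (r p)\<^sup>2 = fst p)"
      by (intro exI [of _ r]) auto
  qed
  from bchoice [OF this] obtain rt where
    rt: "\<forall>v\<in>\<Union>K. continuous_on {p \<in> torus. g p v \<noteq> 0} (rt v) \<and>
      (\<forall>p\<in>torus. g p v \<noteq> 0 \<longrightarrow> (rt v p)\<^sup>2 = fst p)" ..
  \<comment> \<open>Either \<open>{u, v}\<close> is a simplex, possibly with \<open>u = v\<close>,
    or the two stars do not meet.\<close>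
  have conn: "connected {p \<in> torus. g p u \<noteq> 0 \<and> g p v \<noteq> 0}" for u v
  proof (cases "{u, v} \<in> K")
    case True
    then show ?thesis
      using contractible_imp_connected [OF contractible_open_star [OF K homeo True]] by simp
  next
    case False
    have "\<not> (g p u \<noteq> 0 \<and> g p v \<noteq> 0)" if "p \<in> torus" for p
    proof
      assume "g p u \<noteq> 0 \<and> g p v \<noteq> 0"
      then have "{u, v} \<subseteq> {v. g p v \<noteq> 0}" by auto
      then have "{u, v} \<in> K"
        using supp [OF that] K unfolding abstract_simplicial_complex_def by blast
      with False show False ..
    qed
    then have "{p \<in> torus. g p u \<noteq> 0 \<and> g p v \<noteq> 0} = {}" by blast
    then show ?thesis by (simp only: connected_empty)
  qed
  interpret torus_double_cover K h g "\<lambda>v. int (k v) + 1" rt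
    by unfold_locales (use fin K dim homeo inj rt conn in auto)
  show ?thesis
    by (rule euler_characteristic_K)
qed

end
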